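(* Let $\mathbb K$ be an algebraically closed field of characteristic $0$ and let $\mathcal A=\mathbb K[x_1,\dots,x_n]$ be graded so that each $x_i$ is homogeneous of positive degree. Let $R$ be the subalgebra of $\mathcal A$ generated by homogeneous elements $f_1,\dots,f_s$, and assume that the Jacobian locus $\mathcal J(f_1,\dots,f_s)$ has codimension $\ge 2$ in $\mathbb A^n$. Then $R$ is algebraically closed in $\mathcal A$: if $\tilde f\in\mathcal A$ is algebraic over $R$, then $\tilde f\in R$.
   Context: For $g_1,\dots,g_m\in\mathcal A$, the Jacobian locus $\mathcal J(g_1,\dots,g_m)$ is the set of $\xi\in\mathbb A^n$ at which the differentials $d_\xi g_1,\dots,d_\xi g_m$ are linearly dependent; it is Zariski closed. *)

theory Defs
  imports "HOL-Library.Poly_Mapping" "HOL-Computational_Algebra.Polynomial"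
begin

text \<open>Polynomials in the variables of a finite type 'v (n = CARD('v)) over 'k,
  represented as finitely supported maps from monomials (exponent vectors) to coefficients.\<close>
type_synonym ('v, 'k) mpol = "('v \<Rightarrow>\<^sub>0 nat) \<Rightarrow>\<^sub>0 'k"

definition const_mp :: "'k::zero \<Rightarrow> ('v, 'k) mpol" where
  "const_mp c = Poly_Mapping.single 0 c"

definition eval_mp :: "('v::finite, 'k::comm_semiring_1) mpol \<Rightarrow> ('v \<Rightarrow> 'k) \<Rightarrow> 'k" where
  "eval_mp p \<xi> = sum (\<lambda>m. Poly_Mapping.lookup p m * prod (\<lambda>v. \<xi> v ^ Poly_Mapping.lookup m v) UNIV) (Poly_Mapping.keys p)"

definition pderiv_mp :: "'v \<Rightarrow> ('v, 'k::comm_semiring_1) mpol \<Rightarrow> ('v, 'k) mpol" where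
  "pderiv_mp v p = (\<Sum>m\<in>Poly_Mapping.keys p.
      Poly_Mapping.single (m - Poly_Mapping.single v 1) (of_nat (Poly_Mapping.lookup m v) * Poly_Mapping.lookup p m))"

definition homogeneous_mp :: "('v::finite \<Rightarrow> nat) \<Rightarrow> ('v, 'k::zero) mpol \<Rightarrow> bool" where
  "homogeneous_mp w p \<longleftrightarrow> (\<exists>d. \<forall>m\<in>Poly_Mapping.keys p. (\<Sum>v\<in>UNIV. w v * Poly_Mapping.lookup m v) = d)"

inductive_set subalg_gen :: "('v, 'k::comm_semiring_1) mpol set \<Rightarrow> ('v, 'k) mpol set"
  for G where
  gen: "g \<in> G \<Longrightarrow> g \<in> subalg_gen G"
| const: "const_mp c \<in> subalg_gen G"
| add: "p \<in> subalg_gen G \<Longrightarrow> q \<in> subalg_gen G \<Longrightarrow> p + q \<in> subalg_gen G"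
| mult: "p \<in> subalg_gen G \<Longrightarrow> q \<in> subalg_gen G \<Longrightarrow> p * q \<in> subalg_gen G"

definition zariski_closed :: "('v::finite \<Rightarrow> 'k::comm_semiring_1) set \<Rightarrow> bool" where
  "zariski_closed Z \<longleftrightarrow> (\<exists>S. Z = {\<xi>. \<forall>p\<in>S. eval_mp p \<xi> = 0})"

definition zariski_irreducible :: "('v::finite \<Rightarrow> 'k::comm_semiring_1) set \<Rightarrow> bool" where
  "zariski_irreducible W \<longleftrightarrow> W \<noteq> {} \<and> zariski_closed W \<and>
     (\<forall>A B. zariski_closed A \<and> zariski_closed B \<and> W \<subseteq> A \<union> B \<longrightarrow> W \<subseteq> A \<or> W \<subseteq> B)"

definition codim_ge_2 :: "('v::finite \<Rightarrow> 'k::comm_semiring_1) set \<Rightarrow> bool" where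
  "codim_ge_2 Z \<longleftrightarrow> (\<forall>W. zariski_irreducible W \<and> W \<subseteq> Z \<longrightarrow>
      (\<exists>V. zariski_irreducible V \<and> W \<subset> V \<and> V \<subset> UNIV))"

definition jacobian_locus :: "('v::finite, 'k::comm_semiring_1) mpol list \<Rightarrow> ('v \<Rightarrow> 'k) set" where
  "jacobian_locus fs = {\<xi>. \<exists>c::nat \<Rightarrow> 'k. (\<exists>i<length fs. c i \<noteq> 0) \<and>
      (\<forall>v. (\<Sum>i<length fs. c i * eval_mp (pderiv_mp v (fs ! i)) \<xi>) = 0)}"

definition algebraic_over :: "('v, 'k::comm_ring_1) mpol set \<Rightarrow> ('v, 'k) mpol \<Rightarrow> bool" where
  "algebraic_over R g \<longleftrightarrow> (\<exists>P :: ('v, 'k) mpol poly. P \<noteq> 0 \<and> (\<forall>i. coeff P i \<in> R) \<and> poly P g = 0)"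

end

theory Submission
  imports Defs
begin

text \<open>
  If \<open>g\<close> is algebraic over \<open>R\<close>, differentiating a relation of minimal degree gives
  \<open>dg = \<Sum> a\<^sub>j df\<^sub>j\<close> with rational functions \<open>a\<^sub>j\<close>. At every point outside the Jacobian locus
  there are polynomial vector fields \<open>X\<^sub>j\<close> with \<open>X\<^sub>j f\<^sub>i = \<delta>\<^sub>i\<^sub>j \<Delta>\<close> and \<open>\<Delta>\<close> nonzero at
  that point, so the \<open>a\<^sub>j\<close> are regular there; since the locus has codimension at least two, they are
  polynomials. The property that the differential depends on the \<open>df\<^sub>i\<close> passes from \<open>g\<close> to the \<open>a\<^sub>j\<close>,
  because a vector field killing all \<open>f\<^sub>i\<close> also kills them. Finally the Euler
  identity expresses \<open>deg(g) g\<close> as \<open>\<Sum> deg(f\<^sub>j) a\<^sub>j f\<^sub>j\<close> for homogeneous \<open>g\<close>, where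
  the \<open>a\<^sub>j\<close> have smaller degree than \<open>g\<close>, and induction on the degree puts \<open>g\<close> into \<open>R\<close>.

  The extension of a rational function \<open>p / q\<close> over codimension two avoids unique factorization in
  several variables. After a choice of direction \<open>c\<close> along which \<open>q\<close> is monic, one inverts the
  nonzero polynomials that are constant along \<open>c\<close>; what remains is a Euclidean ring, and an irreducible
  factor \<open>\<pi>\<close> of the denominator of \<open>p / q\<close> defines an irreducible hypersurface on which \<open>p / q\<close> is nowhere regular.
\<close>

section \<open>Polynomial ring: monomials, induction on generators, substitution
  homomorphisms\<close>

abbreviation lookup where "lookup \<equiv> Poly_Mapping.lookup"
abbreviation keys where "keys \<equiv> Poly_Mapping.keys"
abbreviation single where "single \<equiv> Poly_Mapping.single"

definition var_mp :: "'v \<Rightarrow> ('v, 'k::comm_semiring_1) mpol" where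
  "var_mp v = single (single v 1) 1"

lemma const_mp_simps [simp]:
  "const_mp 0 = (0 :: ('v, 'k::comm_ring_1) mpol)"
  "const_mp 1 = (1 :: ('v, 'k::comm_ring_1) mpol)"
  "const_mp (a + b) = (const_mp a + const_mp b :: ('v, 'k::comm_ring_1) mpol)"
  "const_mp (a * b) = (const_mp a * const_mp b :: ('v, 'k::comm_ring_1) mpol)"
  by (simp_all add: const_mp_def single_add mult_single)

lemma const_mp_of_nat: "const_mp (of_nat n) = (of_nat n :: ('v, 'k::comm_ring_1) mpol)"
  by (simp add: const_mp_def)

lemma const_mp_power: "const_mp (a ^ n) = (const_mp a ^ n :: ('v, 'k::comm_ring_1) mpol)"
  by (induction n) simp_all

lemma const_mp_inverse [simp]:
  "c \<noteq> 0 \<Longrightarrow> const_mp c * const_mp (inverse c) = (1 :: ('v, 'k::field) mpol)"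
  unfolding const_mp_simps(4)[symmetric] by simp

lemma sum_single_keys: "(\<Sum>m\<in>keys p. single m (lookup p m)) = p"
  by (rule poly_mapping_eqI)
     (auto simp: lookup_sum lookup_single when_def in_keys_iff sum.delta')

lemma single_power: "single m (1::'k::comm_semiring_1) ^ n = single (\<Sum>i<n. m) 1"
  by (induction n) (simp_all add: mult_single add.commute)

lemma prod_single:
  "finite A \<Longrightarrow> (\<Prod>i\<in>A. single (f i) (1::'k::comm_semiring_1)) = single (\<Sum>i\<in>A. f i) 1"
  by (induction A rule: finite_induct) (simp_all add: mult_single)

lemma single_eq_prod_var:
  "single m c = const_mp c * (\<Prod>v\<in>UNIV. var_mp v ^ lookup m v)"
  for m :: "'v::finite \<Rightarrow>\<^sub>0 nat" and c :: "'k::comm_semiring_1"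
proof -
  have "(\<Sum>v\<in>UNIV. \<Sum>i<lookup m v. single v 1) = m"
    by (rule poly_mapping_eqI) (simp add: lookup_sum lookup_single when_def if_distrib[of "(*) _"] sum.delta cong: if_cong)
  then show ?thesis
    by (simp add: var_mp_def single_power prod_single const_mp_def mult_single)
qed

text \<open>Every polynomial is built from constants and variables by sums and products, so
  identities between substitutions or derivations need checking on these generators only.\<close>

lemma mpol_induct [case_names const var add mult]:
  fixes p :: "('v::finite, 'k::comm_ring_1) mpol"
  assumes const: "\<And>c. P (const_mp c)" and var: "\<And>v. P (var_mp v)"
    and add: "\<And>p q. P p \<Longrightarrow> P q \<Longrightarrow> P (p + q)" and mult: "\<And>p q. P p \<Longrightarrow> P q \<Longrightarrow> P (p * q)"
  shows "P p"
proof -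
  have zero: "P 0" and one: "P 1"
    using const[of 0] const[of 1] by simp_all
  have pow: "P (var_mp v ^ n)" for v n
    by (induction n) (auto intro: one var mult)
  have "P (\<Prod>v\<in>A. var_mp v ^ lookup m v)" if "finite A" for m and A :: "'v set"
    using that by (induction A rule: finite_induct) (auto intro: one pow mult)
  then have mono: "P (single m c)" for m c
    unfolding single_eq_prod_var by (auto intro: mult const)
  have "P (\<Sum>m\<in>A. single m (lookup p m))" if "finite A" for A
    using that by (induction A rule: finite_induct) (auto intro: zero mono add)
  from this[of "keys p"] show ?thesis
    by (simp add: sum_single_keys)
qed

definition ring_hom_fn :: "('a::comm_ring_1 \<Rightarrow> 'b::comm_ring_1) \<Rightarrow> bool" where
  "ring_hom_fn h \<longleftrightarrow> h 1 = 1 \<and> (\<forall>a b. h (a + b) = h a + h b) \<and> (\<forall>a b. h (a * b) = h a * h b)"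

lemma ring_hom_fnD:
  assumes "ring_hom_fn h"
  shows "h 1 = 1" "h (a + b) = h a + h b" "h (a * b) = h a * h b" "h 0 = 0"
    "h (- a) = - h a" "h (a - b) = h a - h b" "h (a ^ n) = h a ^ n"
    "h (sum f A) = (\<Sum>x\<in>A. h (f x))" "h (prod f A) = (\<Prod>x\<in>A. h (f x))"
proof -
  have 1: "h 1 = 1" and add: "\<And>a b. h (a + b) = h a + h b" and mult: "\<And>a b. h (a * b) = h a * h b"
    using assms by (auto simp: ring_hom_fn_def)
  have 0: "h 0 = 0"
    using add[of 0 0] by simp
  have um: "h (- a) = - h a" for a
    using add[of a "- a"] 0 by (simp add: eq_neg_iff_add_eq_0 add.commute)
  show "h 1 = 1" "h (a + b) = h a + h b" "h (a * b) = h a * h b" "h 0 = 0" "h (- a) = - h a"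
    by (fact 1 add mult 0 um)+
  show "h (a - b) = h a - h b"
    using add[of a "- b"] um[of b] by simp
  show "h (a ^ n) = h a ^ n"
    by (induction n) (simp_all add: 1 mult)
  show "h (sum f A) = (\<Sum>x\<in>A. h (f x))"
    by (induction A rule: infinite_finite_induct) (simp_all add: 0 add)
  show "h (prod f A) = (\<Prod>x\<in>A. h (f x))"
    by (induction A rule: infinite_finite_induct) (simp_all add: 1 mult)
qed

text \<open>The coefficient map is a parameter so that \<open>eval_mp\<close> (into the field) and
  \<open>shift_mp\<close> (into univariate polynomials over \<open>mpol\<close>) share one proof of
  multiplicativity.\<close>

definition subst_mp :: "('k::comm_ring_1 \<Rightarrow> 'c::comm_ring_1) \<Rightarrow> ('v::finite \<Rightarrow> 'c) \<Rightarrow> ('v, 'k) mpol \<Rightarrow> 'c" where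
  "subst_mp \<phi> x p = (\<Sum>m\<in>keys p. \<phi> (lookup p m) * (\<Prod>v\<in>UNIV. x v ^ lookup m v))"

lemma subst_mp_single:
  "ring_hom_fn \<phi> \<Longrightarrow> subst_mp \<phi> x (single m c) = \<phi> c * (\<Prod>v\<in>UNIV. x v ^ lookup m v)"
  by (cases "c = 0") (simp_all add: subst_mp_def ring_hom_fnD(4))

lemma subst_mp_add:
  "ring_hom_fn \<phi> \<Longrightarrow> subst_mp \<phi> x (p + q) = subst_mp \<phi> x p + subst_mp \<phi> x q"
  unfolding subst_mp_def
  by (intro setsum_keys_plus_distrib) (simp_all add: ring_hom_fnD distrib_right)

lemma subst_mp_sum:
  assumes "ring_hom_fn \<phi>"
  shows "subst_mp \<phi> x (\<Sum>i\<in>A. f i) = (\<Sum>i\<in>A. subst_mp \<phi> x (f i))"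
proof -
  have "subst_mp \<phi> x 0 = 0"
    by (simp add: subst_mp_def)
  then show ?thesis
    by (induction A rule: infinite_finite_induct) (simp_all add: subst_mp_add[OF assms])
qed

lemma subst_mp_hom:
  assumes "ring_hom_fn \<phi>"
  shows "ring_hom_fn (subst_mp \<phi> x)"
proof -
  note hom = ring_hom_fnD[OF assms]
  have "subst_mp \<phi> x (p * q) = subst_mp \<phi> x p * subst_mp \<phi> x q" for p q
  proof -
    let ?t = "\<lambda>p m. single m (lookup p m)"
    have "subst_mp \<phi> x (?t p m * ?t q n) = subst_mp \<phi> x (?t p m) * subst_mp \<phi> x (?t q n)" for m n
      by (simp add: mult_single subst_mp_single[OF assms] lookup_add power_add prod.distrib hom mult_ac)
    then have "subst_mp \<phi> x ((\<Sum>m\<in>keys p. ?t p m) * (\<Sum>n\<in>keys q. ?t q n)) =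
        subst_mp \<phi> x (\<Sum>m\<in>keys p. ?t p m) * subst_mp \<phi> x (\<Sum>n\<in>keys q. ?t q n)"
      by (simp add: sum_product subst_mp_sum[OF assms])
    then show ?thesis
      by (simp add: sum_single_keys)
  qed
  moreover have "subst_mp \<phi> x 1 = 1"
    using subst_mp_single[OF assms, of x 0 1] by (simp add: hom)
  ultimately show ?thesis
    by (simp add: ring_hom_fn_def subst_mp_add[OF assms])
qed

lemma subst_mp_const [simp]: "ring_hom_fn \<phi> \<Longrightarrow> subst_mp \<phi> x (const_mp c) = \<phi> c"
  by (simp add: const_mp_def subst_mp_single)

lemma subst_mp_var [simp]:
  assumes "ring_hom_fn \<phi>"
  shows "subst_mp \<phi> x (var_mp v) = x v"
proof -
  have "(\<Prod>u\<in>UNIV. x u ^ lookup (single v 1) u) = (\<Prod>u\<in>UNIV. if u = v then x v else 1)"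
    by (intro prod.cong) (auto simp: lookup_single)
  then show ?thesis
    by (simp add: var_mp_def subst_mp_single[OF assms] ring_hom_fnD[OF assms])
qed

lemma ring_hom_fn_id: "ring_hom_fn (\<lambda>c. c)"
  by (simp add: ring_hom_fn_def)

lemma eval_eq_subst: "eval_mp p \<xi> = subst_mp (\<lambda>c. c) \<xi> p"
  by (simp add: eval_mp_def subst_mp_def)

lemma eval_hom: "ring_hom_fn (\<lambda>p. eval_mp p (\<xi> :: 'v::finite \<Rightarrow> 'k::comm_ring_1))"
  unfolding eval_eq_subst by (rule subst_mp_hom[OF ring_hom_fn_id])

lemmas eval_simps [simp] = ring_hom_fnD[OF eval_hom]

lemma eval_const [simp]: "eval_mp (const_mp c) \<xi> = (c :: 'k::comm_ring_1)"
  by (simp add: eval_eq_subst ring_hom_fn_id)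

lemma eval_var [simp]: "eval_mp (var_mp v) \<xi> = (\<xi> v :: 'k::comm_ring_1)"
  by (simp add: eval_eq_subst ring_hom_fn_id)

lemma ring_hom_fn_const_poly: "ring_hom_fn (\<lambda>c. [:const_mp c:] :: ('v, 'k::comm_ring_1) mpol poly)"
  by (simp add: ring_hom_fn_def one_pCons)

subsection \<open>Polynomials as functions\<close>

text \<open>Induction over the set \<open>S\<close> of variables whose exponents are fixed to those
  of \<open>m0\<close>: scaling one more variable by \<open>s\<close> gives a univariate polynomial
  vanishing on an infinite field, so each of its coefficients vanishes. The set \<open>M\<close> is
  arbitrary so that top-degree parts are covered too.\<close>

lemma monomial_sum_eq_0:
  fixes a :: "('v::finite \<Rightarrow>\<^sub>0 nat) \<Rightarrow> 'k::field_char_0"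
  assumes fin: "finite M" and zero: "\<And>\<xi>. (\<Sum>m\<in>M. a m * (\<Prod>v\<in>UNIV. \<xi> v ^ lookup m v)) = 0"
    and m0: "m0 \<in> M"
  shows "a m0 = 0"
proof -
  have *: "(\<Sum>m | m \<in> M \<and> (\<forall>v\<in>S. lookup m v = lookup m0 v). a m * (\<Prod>v\<in>UNIV. \<xi> v ^ lookup m v)) = 0"
    if "finite S" for S \<xi>
    using that
  proof (induction S arbitrary: \<xi> rule: finite_induct)
    case empty
    then show ?case using zero by simp
  next
    case (insert u S)
    define N where "N = {m \<in> M. \<forall>v\<in>S. lookup m v = lookup m0 v}"
    define b where "b m = a m * (\<Prod>v\<in>UNIV. \<xi> v ^ lookup m v)" for m
    define P where "P = (\<Sum>m\<in>N. monom (b m) (lookup m u))"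
    have "poly P s = 0" for s
    proof -
      have prod: "(\<Prod>v\<in>UNIV. (if v = u then s * \<xi> u else \<xi> v) ^ lookup m v)
          = s ^ lookup m u * (\<Prod>v\<in>UNIV. \<xi> v ^ lookup m v)" for m
      proof -
        have "(\<Prod>v\<in>UNIV - {u}. (if v = u then s * \<xi> u else \<xi> v) ^ lookup m v)
            = (\<Prod>v\<in>UNIV - {u}. \<xi> v ^ lookup m v)"
          by (intro prod.cong) auto
        then show ?thesis
          by (subst (1 2) prod.remove[of UNIV u]) (auto simp: power_mult_distrib mult_ac)
      qed
      have "poly P s = (\<Sum>m\<in>N. a m * (\<Prod>v\<in>UNIV. (if v = u then s * \<xi> u else \<xi> v) ^ lookup m v))"
        unfolding P_def poly_sum poly_monom b_def prod by (intro sum.cong) (auto simp: mult_ac)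
      also have "\<dots> = 0"
        unfolding N_def by (rule insert.IH)
      finally show ?thesis .
    qed
    then have "P = 0"
      using poly_all_0_iff_0 by blast
    then have "(\<Sum>m\<in>N. if lookup m u = lookup m0 u then b m else 0) = 0"
      using arg_cong[of P 0 "\<lambda>P. coeff P (lookup m0 u)"] unfolding P_def coeff_sum by simp
    then have "(\<Sum>m\<in>{m\<in>N. lookup m u = lookup m0 u}. b m) = 0"
      using fin by (subst sum.inter_filter) (auto simp: N_def)
    also have "{m\<in>N. lookup m u = lookup m0 u} = {m. m \<in> M \<and> (\<forall>v\<in>insert u S. lookup m v = lookup m0 v)}"
      by (auto simp: N_def)
    finally show ?case
      by (simp add: b_def)
  qed
  \<comment> \<open>With all exponents fixed only \<open>m0\<close> is left, and its monomial equals
    1 at the all-ones point.\<close>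
  have "{m. m \<in> M \<and> (\<forall>v\<in>UNIV. lookup m v = lookup m0 v)} = {m0}"
    using m0 by (auto intro: poly_mapping_eqI)
  then show ?thesis
    using *[of UNIV "\<lambda>_. 1"] by simp
qed

lemma eval_mp_eq_0D:
  fixes p :: "('v::finite, 'k::field_char_0) mpol"
  assumes "\<And>\<xi>. eval_mp p \<xi> = 0"
  shows "p = 0"
proof (rule poly_mapping_eqI)
  fix m
  show "lookup p m = lookup 0 m"
    using monomial_sum_eq_0[of "keys p" "lookup p" m] assms
    by (cases "m \<in> keys p") (auto simp: eval_mp_def in_keys_iff)
qed

lemma ex_eval_mp_nonzero:
  fixes p :: "('v::finite, 'k::field_char_0) mpol"
  assumes "p \<noteq> 0"
  obtains \<xi> where "eval_mp p \<xi> \<noteq> 0"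
  using assms eval_mp_eq_0D by blast

text \<open>\<open>shift_mp c p\<close> is the polynomial \<open>p(x + s c)\<close> in the new variable \<open>s\<close>.\<close>
definition shift_mp :: "('v \<Rightarrow> 'k) \<Rightarrow> ('v::finite, 'k::comm_ring_1) mpol \<Rightarrow> ('v, 'k) mpol poly" where
  "shift_mp c = subst_mp (\<lambda>k. [:const_mp k:]) (\<lambda>v. [:var_mp v, const_mp (c v):])"

lemma shift_hom: "ring_hom_fn (shift_mp c)"
  unfolding shift_mp_def by (rule subst_mp_hom[OF ring_hom_fn_const_poly])

lemmas shift_simps [simp] = ring_hom_fnD[OF shift_hom]

lemma shift_const [simp]: "shift_mp c (const_mp k) = [:const_mp k:]"
  by (simp add: shift_mp_def ring_hom_fn_const_poly)

lemma shift_var [simp]: "shift_mp c (var_mp v) = [:var_mp v, const_mp (c v):]"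
  by (simp add: shift_mp_def ring_hom_fn_const_poly)

lemma poly_map_eval:
  "poly (map_poly (\<lambda>a. eval_mp a \<xi>) P) s = eval_mp (poly P (const_mp s)) (\<xi> :: 'v::finite \<Rightarrow> 'k::comm_ring_1)"
proof (induction P)
  case 0
  then show ?case by simp
next
  case (pCons a P)
  then show ?case by (subst map_poly_pCons) (auto simp: mult.commute)
qed

lemma eval_poly_shift:
  "eval_mp (poly (shift_mp c p) (const_mp s)) \<xi> = eval_mp p (\<lambda>v. \<xi> v + s * c v)"
  by (induction p rule: mpol_induct) simp_all

definition line_mp :: "('v \<Rightarrow> 'k) \<Rightarrow> ('v \<Rightarrow> 'k) \<Rightarrow> ('v::finite, 'k::comm_ring_1) mpol \<Rightarrow> 'k poly" where
  "line_mp \<xi> c p = map_poly (\<lambda>a. eval_mp a \<xi>) (shift_mp c p)"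

lemma poly_line: "poly (line_mp \<xi> c p) s = eval_mp p (\<lambda>v. \<xi> v + s * c v)"
  by (simp add: line_mp_def poly_map_eval eval_poly_shift)

lemma coeff_line: "coeff (line_mp \<xi> c p) i = eval_mp (coeff (shift_mp c p) i) \<xi>"
  by (simp add: line_mp_def coeff_map_poly)

lemma poly_shift_0: "poly (shift_mp c p) 0 = p"
  by (induction p rule: mpol_induct) simp_all

text \<open>Restrict both polynomials to the line joining a non-zero of each.\<close>
lemma ex_eval_mp_nonzero2:
  fixes p q :: "('v::finite, 'k::field_char_0) mpol"
  assumes "eval_mp p \<xi> \<noteq> 0" "eval_mp q \<eta> \<noteq> 0"
  obtains \<zeta> where "eval_mp p \<zeta> \<noteq> 0" "eval_mp q \<zeta> \<noteq> 0"
proof -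
  define c where "c v = \<eta> v - \<xi> v" for v
  let ?P = "line_mp \<xi> c p" and ?Q = "line_mp \<xi> c q"
  have "poly ?P 0 \<noteq> 0" "poly ?Q 1 \<noteq> 0"
    using assms by (simp_all add: poly_line c_def)
  then have "?P * ?Q \<noteq> 0"
    by auto
  then obtain s where "poly (?P * ?Q) s \<noteq> 0"
    using poly_all_0_iff_0 by blast
  then show ?thesis
    by (intro that[of "\<lambda>v. \<xi> v + s * c v"]) (auto simp: poly_line)
qed

text \<open>Two nonzero polynomials have a common point of nonvanishing, where their product is
  nonzero as well.\<close>

lemma mpol_no_zero_div:
  fixes p q :: "('v::finite, 'k::field_char_0) mpol"
  shows "p * q = 0 \<longleftrightarrow> p = 0 \<or> q = 0"
proof
  assume *: "p * q = 0"
  show "p = 0 \<or> q = 0"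
  proof (rule ccontr)
    assume "\<not> (p = 0 \<or> q = 0)"
    then obtain \<xi> \<eta> where "eval_mp p \<xi> \<noteq> 0" "eval_mp q \<eta> \<noteq> 0"
      by (metis ex_eval_mp_nonzero)
    then obtain \<zeta> where "eval_mp p \<zeta> \<noteq> 0" "eval_mp q \<zeta> \<noteq> 0"
      by (rule ex_eval_mp_nonzero2)
    then show False
      using arg_cong[OF *, of "\<lambda>p. eval_mp p \<zeta>"] by simp
  qed
qed auto

lemma mpol_mult_cancel_left:
  fixes p q r :: "('v::finite, 'k::field_char_0) mpol"
  assumes "p * q = p * r" "p \<noteq> 0"
  shows "q = r"
  using mpol_no_zero_div[of p "q - r"] assms by (simp add: right_diff_distrib)

lemma mpol_power_eq_0 [simp]: "p ^ n = 0 \<longleftrightarrow> p = 0 \<and> n > 0"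
  for p :: "('v::finite, 'k::field_char_0) mpol"
  by (induction n) (auto simp: mpol_no_zero_div)

lemma mpol_of_nat_eq_0:
  "of_nat n * (p :: ('v::finite, 'k::field_char_0) mpol) = 0 \<longleftrightarrow> n = 0 \<or> p = 0"
  by (simp add: mpol_no_zero_div)

subsection \<open>Polynomial vector fields\<close>

lemma diff_single_add:
  assumes "lookup m v > 0"
  shows "m - single v (Suc 0) + single v (Suc 0) = m"
  using assms by (intro poly_mapping_eqI) (auto simp: lookup_add lookup_minus lookup_single when_def)

lemma add_diff_single:
  assumes "lookup m v > 0"
  shows "m + n - single v (Suc 0) = m - single v (Suc 0) + n"
  using assms by (intro poly_mapping_eqI) (auto simp: lookup_add lookup_minus lookup_single when_def)

lemma pderiv_mp_single:
  "pderiv_mp v (single m c) = single (m - single v 1) (of_nat (lookup m v) * c)"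
  by (cases "c = 0") (simp_all add: pderiv_mp_def)

lemma pderiv_mp_add: "pderiv_mp v (p + q) = pderiv_mp v p + pderiv_mp v q"
  unfolding pderiv_mp_def
  by (intro setsum_keys_plus_distrib) (simp_all add: single_add distrib_left)

lemma pderiv_mp_0 [simp]: "pderiv_mp v 0 = 0"
  by (simp add: pderiv_mp_def)

lemma pderiv_mp_sum: "pderiv_mp v (\<Sum>i\<in>A. f i) = (\<Sum>i\<in>A. pderiv_mp v (f i))"
  by (induction A rule: infinite_finite_induct) (simp_all add: pderiv_mp_add)

lemma pderiv_mp_mult:
  fixes p q :: "('v, 'k::comm_ring_1) mpol"
  shows "pderiv_mp v (p * q) = pderiv_mp v p * q + p * pderiv_mp v q"
proof -
  let ?t = "\<lambda>p m. single m (lookup p m)"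
  \<comment> \<open>Exponent subtraction is truncated. If \<open>v\<close> does not occur in
    \<open>m\<close>, both sides vanish through the factor \<open>of_nat (lookup m v)\<close>;
    otherwise subtracting from \<open>m\<close> commutes with adding \<open>n\<close>.\<close>
  have part: "single (m + n - single v 1) (of_nat (lookup m v) * (a * b))
      = pderiv_mp v (single m a) * single n b" for m n and a b :: 'k
    by (cases "lookup m v = 0") (simp_all add: pderiv_mp_single mult_single add_diff_single mult_ac add.commute)
  have "pderiv_mp v (single m a * single n b)
      = pderiv_mp v (single m a) * single n b + single m a * pderiv_mp v (single n b)" for m n and a b :: 'k
    using part[of m n a b] part[of n m b a]
    by (simp add: pderiv_mp_single[of _ "m + n"] mult_single lookup_add single_add algebra_simps)
  then have "pderiv_mp v ((\<Sum>m\<in>keys p. ?t p m) * (\<Sum>n\<in>keys q. ?t q n))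
      = pderiv_mp v (\<Sum>m\<in>keys p. ?t p m) * (\<Sum>n\<in>keys q. ?t q n)
        + (\<Sum>m\<in>keys p. ?t p m) * pderiv_mp v (\<Sum>n\<in>keys q. ?t q n)"
    by (simp add: sum_product pderiv_mp_sum sum.distrib)
  then show ?thesis
    by (simp add: sum_single_keys)
qed

lemma pderiv_mp_const: "pderiv_mp v (const_mp c) = 0"
  by (simp add: const_mp_def pderiv_mp_single)

lemma pderiv_mp_var: "pderiv_mp v (var_mp u) = (if u = v then 1 else 0)"
  by (simp add: var_mp_def pderiv_mp_single lookup_single when_def)

definition vf :: "('v \<Rightarrow> ('v, 'k) mpol) \<Rightarrow> ('v::finite, 'k::comm_ring_1) mpol \<Rightarrow> ('v, 'k) mpol" where
  "vf X p = (\<Sum>v\<in>UNIV. X v * pderiv_mp v p)"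

lemma vf_add: "vf X (p + q) = vf X p + vf X q"
  by (simp add: vf_def pderiv_mp_add distrib_left sum.distrib)

lemma vf_mult: "vf X (p * q) = vf X p * q + p * vf X q"
  unfolding vf_def
  by (simp add: pderiv_mp_mult distrib_left sum.distrib sum_distrib_left sum_distrib_right mult_ac)

lemma vf_const [simp]: "vf X (const_mp c) = 0"
  by (simp add: vf_def pderiv_mp_const)

lemma vf_0 [simp]: "vf X 0 = 0"
  using vf_const[of X 0] by simp

lemma vf_var: "vf X (var_mp v) = X v"
proof -
  have "vf X (var_mp v) = (\<Sum>u\<in>UNIV. if v = u then X u else 0)"
    unfolding vf_def by (intro sum.cong) (auto simp: pderiv_mp_var)
  then show ?thesis
    by simp
qed

lemma vf_sum: "vf X (\<Sum>i\<in>A. f i) = (\<Sum>i\<in>A. vf X (f i))"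
  by (induction A rule: infinite_finite_induct) (simp_all add: vf_add)

lemma vf_power_Suc: "vf X (p ^ Suc n) = of_nat (Suc n) * p ^ n * vf X p"
proof (induction n)
  case (Suc n)
  have "vf X (p ^ Suc (Suc n)) = vf X p * p ^ Suc n + p * vf X (p ^ Suc n)"
    by (simp only: power_Suc[of p "Suc n"] vf_mult)
  also have "\<dots> = of_nat (Suc (Suc n)) * p ^ Suc n * vf X p"
    unfolding Suc.IH by (simp add: algebra_simps)
  finally show ?case .
qed simp

text \<open>The commutator of two derivations is again a derivation, and a derivation is determined
  by its values on the variables.\<close>

lemma vf_bracket:
  "vf D (vf X p) - vf X (vf D p) = vf (\<lambda>v. vf D (X v) - vf X (D v)) p"
proof (induction p rule: mpol_induct)
  case (mult p q)
  let ?Z = "\<lambda>v. vf D (X v) - vf X (D v)"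
  have "vf D (vf X (p * q)) - vf X (vf D (p * q))
      = (vf D (vf X p) - vf X (vf D p)) * q + p * (vf D (vf X q) - vf X (vf D q))"
    by (simp add: vf_mult vf_add algebra_simps)
  also have "\<dots> = vf ?Z (p * q)"
    by (simp only: mult vf_mult)
  finally show ?case .
next
  case (add p q)
  then show ?case by (simp add: vf_add algebra_simps)
qed (simp_all add: vf_var)

lemma vf_single_direction: "vf (\<lambda>u. if u = v then a else 0) p = a * pderiv_mp v p"
proof -
  have "vf (\<lambda>u. if u = v then a else 0) p = (\<Sum>u\<in>UNIV. if u = v then a * pderiv_mp v p else 0)"
    unfolding vf_def by (intro sum.cong) auto
  then show ?thesis
    by simp
qed

lemma vf_diff_field: "vf (\<lambda>v. X v - Y v) p = vf X p - vf Y p"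
  by (simp add: vf_def left_diff_distrib sum_subtractf)

lemma vf_scale_field: "vf (\<lambda>v. a * X v) p = a * vf X p"
  by (simp add: vf_def sum_distrib_left mult_ac)

lemma vf_sum_field: "vf (\<lambda>v. \<Sum>j\<in>A. X j v) p = (\<Sum>j\<in>A. vf (X j) p)"
  unfolding vf_def by (simp add: sum_distrib_right) (rule sum.swap)

text \<open>Equivalently, the differential of \<open>g\<close> lies in the span of those of \<open>fs\<close> over the field of
  rational functions.\<close>
definition dependent_on :: "('v::finite, 'k::comm_ring_1) mpol list \<Rightarrow> ('v, 'k) mpol \<Rightarrow> bool" where
  "dependent_on fs g \<longleftrightarrow> (\<forall>D. (\<forall>f\<in>set fs. vf D f = 0) \<longrightarrow> vf D g = 0)"

section \<open>Algebraic elements have dependent differentials\<close>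

lemma subalg_gen_of_nat_mult:
  fixes r :: "('v, 'k::comm_ring_1) mpol"
  assumes "r \<in> subalg_gen G"
  shows "of_nat n * r \<in> subalg_gen G"
  using subalg_gen.mult[OF subalg_gen.const[of "of_nat n"] assms] by (simp add: const_mp_of_nat)

lemma subalg_gen_0: "(0 :: ('v, 'k::comm_ring_1) mpol) \<in> subalg_gen G"
  using subalg_gen.const[of 0 G] by simp

lemma subalg_gen_sum:
  fixes f :: "'i \<Rightarrow> ('v, 'k::comm_ring_1) mpol"
  assumes "\<And>i. i \<in> A \<Longrightarrow> f i \<in> subalg_gen G"
  shows "(\<Sum>i\<in>A. f i) \<in> subalg_gen G"
  using assms
  by (induction A rule: infinite_finite_induct) (auto intro: subalg_gen_0 subalg_gen.add)

text \<open>A field \<open>D\<close> killing the generators kills the coefficients of a relation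
  \<open>P\<close>, so applying \<open>D\<close> to \<open>poly P g = 0\<close> leaves P'(g) times
  \<open>vf D g\<close>. Minimality of the degree of \<open>P\<close> keeps P'(g) nonzero.\<close>

lemma algebraic_imp_dependent_on:
  fixes g :: "('v::finite, 'k::field_char_0) mpol"
  assumes "algebraic_over (subalg_gen (set fs)) g"
  shows "dependent_on fs g"
  unfolding dependent_on_def
proof (intro allI impI)
  fix D :: "'v \<Rightarrow> ('v, 'k) mpol"
  assume D: "\<forall>f\<in>set fs. vf D f = 0"
  let ?R = "subalg_gen (set fs)"
  let ?rel = "\<lambda>P. P \<noteq> 0 \<and> (\<forall>i. coeff P i \<in> ?R) \<and> poly P g = 0"
  have R: "vf D r = 0" if "r \<in> ?R" for r
    using that by induction (use D in \<open>auto simp: vf_add vf_mult\<close>)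
  obtain P where P: "?rel P" and min: "\<And>Q. ?rel Q \<Longrightarrow> degree P \<le> degree Q"
    using assms ex_has_least_nat[of ?rel _ degree] unfolding algebraic_over_def by blast
  define n where "n = degree P"
  \<comment> \<open>\<open>Q\<close> is the formal derivative of \<open>P\<close>; characteristic 0
    makes its leading coefficient nonzero.\<close>
  define Q where "Q = (\<Sum>i<n. monom (of_nat (Suc i) * coeff P (Suc i)) i)"
  have coeff_Q: "coeff Q i = (if i < n then of_nat (Suc i) * coeff P (Suc i) else 0)" for i
    unfolding Q_def coeff_sum coeff_monom by (simp add: sum.delta)
  have "n > 0"
  proof (rule ccontr)
    assume "\<not> n > 0"
    then obtain a where "P = [:a:]"
      using degree_eq_zeroE[of P] by (auto simp: n_def)
    then show False
      using P by auto
  qed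
  then have "coeff Q (n - 1) = of_nat n * coeff P n"
    by (simp add: coeff_Q)
  moreover have "coeff P n \<noteq> 0"
    using P by (simp add: n_def)
  ultimately have "coeff Q (n - 1) \<noteq> 0"
    using \<open>n > 0\<close> by (simp add: mpol_of_nat_eq_0)
  then have "Q \<noteq> 0"
    by auto
  have "degree Q < n"
    using \<open>n > 0\<close> by (intro degree_lessI) (auto simp: coeff_Q)
  moreover have "coeff Q i \<in> ?R" for i
    unfolding coeff_Q using P by (auto intro: subalg_gen_of_nat_mult subalg_gen_0 simp del: of_nat_Suc)
  ultimately have "poly Q g \<noteq> 0"
    using min[of Q] \<open>Q \<noteq> 0\<close> by (auto simp: n_def)
  have coeff_0: "vf D (coeff P i) = 0" for i
    using P R by blast
  have "poly P g = coeff P 0 + (\<Sum>i<n. coeff P (Suc i) * g ^ Suc i)"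
    unfolding poly_altdef n_def[symmetric] by (simp add: sum.atMost_shift)
  then have "vf D (poly P g) = (\<Sum>i<n. coeff P (Suc i) * vf D (g ^ Suc i))"
    by (simp add: vf_add vf_sum vf_mult coeff_0 del: power_Suc)
  also have "\<dots> = poly Q g * vf D g"
    unfolding Q_def poly_sum poly_monom vf_power_Suc sum_distrib_right by (intro sum.cong) (auto simp: mult_ac)
  finally have "poly Q g * vf D g = 0"
    using P by simp
  then show "vf D g = 0"
    using \<open>poly Q g \<noteq> 0\<close> by (simp add: mpol_no_zero_div)
qed

section \<open>Vector fields dual to the differentials of the generators, up to a common
  denominator\<close>

definition dual_frame ::
  "('v::finite, 'k::comm_ring_1) mpol list \<Rightarrow> nat \<Rightarrow> (nat \<Rightarrow> 'v \<Rightarrow> ('v, 'k) mpol) \<Rightarrow> ('v, 'k) mpol \<Rightarrow> bool" where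
  "dual_frame fs k X \<Delta> \<longleftrightarrow> (\<forall>i<k. \<forall>j<k. vf (X j) (fs ! i) = (if i = j then \<Delta> else 0))"

text \<open>The part of \<open>\<Delta> \<partial>\<^sub>v\<close> that annihilates the first \<open>k\<close> functions.\<close>
definition normal_part where
  "normal_part fs k X \<Delta> v =
     (\<lambda>u. (if u = v then \<Delta> else 0) - (\<Sum>j<k. pderiv_mp v (fs ! j) * X j u))"

lemma vf_normal_part:
  "vf (normal_part fs k X \<Delta> v) p = \<Delta> * pderiv_mp v p - (\<Sum>j<k. pderiv_mp v (fs ! j) * vf (X j) p)"
  by (simp add: normal_part_def vf_diff_field vf_single_direction vf_sum_field vf_scale_field)

lemma vf_normal_part_eq_0:
  assumes "dual_frame fs k X \<Delta>" "i < k"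
  shows "vf (normal_part fs k X \<Delta> v) (fs ! i) = 0"
proof -
  have "(\<Sum>j<k. pderiv_mp v (fs ! j) * vf (X j) (fs ! i))
      = (\<Sum>j<k. if i = j then pderiv_mp v (fs ! j) * \<Delta> else 0)"
    using assms by (intro sum.cong) (auto simp: dual_frame_def)
  also have "\<dots> = pderiv_mp v (fs ! i) * \<Delta>"
    using assms by simp
  finally show ?thesis
    by (simp add: vf_normal_part mult.commute)
qed

text \<open>A Gram-Schmidt process without division: the fields in \<open>normal_part\<close> kill
  the first \<open>k\<close> functions, and independence of the differentials at
  \<open>\<xi>\<close> makes one of them act on the next function with a value nonzero at
  \<open>\<xi>\<close>.\<close>

lemma ex_dual_frame_upto:
  fixes fs :: "('v::finite, 'k::field_char_0) mpol list"
  assumes \<xi>: "\<xi> \<notin> jacobian_locus fs" and "k \<le> length fs"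
  shows "\<exists>X \<Delta>. dual_frame fs k X \<Delta> \<and> eval_mp \<Delta> \<xi> \<noteq> 0"
  using \<open>k \<le> length fs\<close>
proof (induction k)
  case 0
  have "dual_frame fs 0 (\<lambda>_ _. 0) 1"
    by (simp add: dual_frame_def)
  then show ?case
    by (metis eval_simps(1) one_neq_zero)
next
  case (Suc k)
  then obtain X \<Delta> where frame: "dual_frame fs k X \<Delta>" and \<Delta>: "eval_mp \<Delta> \<xi> \<noteq> 0"
    by auto
  define f where "f = fs ! k"
  have "\<exists>v. eval_mp (vf (normal_part fs k X \<Delta> v) f) \<xi> \<noteq> 0"
  proof (rule ccontr)
    assume *: "\<not> ?thesis"
    \<comment> \<open>If all normal parts kill \<open>f\<close> at \<open>\<xi>\<close>, then
      \<Delta> df = \<Sum> (X_i f) df_i holds there. Its coefficients, padded by 0 beyond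
      \<open>k\<close>, form a nontrivial relation because \<open>\<Delta>\<close> does not vanish
      at \<open>\<xi>\<close>.\<close>
    define c where "c i = (if i < k then - eval_mp (vf (X i) f) \<xi> else if i = k then eval_mp \<Delta> \<xi> else 0)" for i
    have "(\<Sum>i<length fs. c i * eval_mp (pderiv_mp v (fs ! i)) \<xi>) = 0" for v
    proof -
      have "(\<Sum>i<length fs. c i * eval_mp (pderiv_mp v (fs ! i)) \<xi>)
          = (\<Sum>i<Suc k. c i * eval_mp (pderiv_mp v (fs ! i)) \<xi>)"
        using Suc.prems by (intro sum.mono_neutral_right) (auto simp: c_def)
      also have "\<dots> = eval_mp \<Delta> \<xi> * eval_mp (pderiv_mp v f) \<xi>
          - (\<Sum>i<k. eval_mp (pderiv_mp v (fs ! i)) \<xi> * eval_mp (vf (X i) f) \<xi>)"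
        by (simp add: c_def f_def sum_negf mult.commute)
      also have "\<dots> = eval_mp (vf (normal_part fs k X \<Delta> v) f) \<xi>"
        by (simp add: vf_normal_part)
      finally show ?thesis
        using * by simp
    qed
    moreover have "\<exists>i<length fs. c i \<noteq> 0"
      using Suc.prems \<Delta> by (intro exI[of _ k]) (auto simp: c_def)
    ultimately show False
      using \<xi> unfolding jacobian_locus_def by blast
  qed
  then obtain v where v: "eval_mp (vf (normal_part fs k X \<Delta> v) f) \<xi> \<noteq> 0"
    by blast
  define Y where "Y = normal_part fs k X \<Delta> v"
  define \<Delta>' where "\<Delta>' = vf Y f"
  \<comment> \<open>\<open>Y\<close> becomes the new field; a multiple of it is subtracted from the
    old ones so that they kill \<open>f\<close>. The factors \<open>\<Delta>\<close> and
    \<open>\<Delta>'\<close> bring all diagonal values to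
    \<open>\<Delta> * \<Delta>'\<close>.\<close>
  define X' where "X' j u = (if j = k then \<Delta> * Y u else \<Delta>' * X j u - vf (X j) f * Y u)" for j u
  have vf_X': "vf (X' j) p = (if j = k then \<Delta> * vf Y p else \<Delta>' * vf (X j) p - vf (X j) f * vf Y p)" for j p
    unfolding X'_def by (cases "j = k") (simp_all add: vf_diff_field vf_scale_field)
  have Y0: "vf Y (fs ! i) = 0" if "i < k" for i
    unfolding Y_def using vf_normal_part_eq_0[OF frame that] .
  have "dual_frame fs (Suc k) X' (\<Delta> * \<Delta>')"
    unfolding dual_frame_def
  proof (intro allI impI)
    fix i j
    assume "i < Suc k" "j < Suc k"
    then consider "i < k" "j < k" | "i < k" "j = k" | "i = k" "j < k" | "i = k" "j = k"
      by linarith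
    then show "vf (X' j) (fs ! i) = (if i = j then \<Delta> * \<Delta>' else 0)"
    proof cases
      case 1
      then have "vf (X j) (fs ! i) = (if i = j then \<Delta> else 0)"
        using frame by (auto simp: dual_frame_def)
      then show ?thesis
        using 1 by (simp add: vf_X' Y0 mult.commute)
    qed (simp_all add: vf_X' Y0 \<Delta>'_def f_def mult.commute)
  qed
  moreover have "eval_mp (\<Delta> * \<Delta>') \<xi> \<noteq> 0"
    using \<Delta> v by (simp add: \<Delta>'_def Y_def)
  ultimately show ?case
    by blast
qed

lemma ex_dual_frame:
  fixes fs :: "('v::finite, 'k::field_char_0) mpol list"
  assumes "\<xi> \<notin> jacobian_locus fs"
  obtains X \<Delta> where "dual_frame fs (length fs) X \<Delta>" "eval_mp \<Delta> \<xi> \<noteq> 0"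
  using ex_dual_frame_upto[OF assms order_refl] by blast

text \<open>The normal parts kill all of \<open>fs\<close>, hence \<open>g\<close>; written out,
  this is the expansion of the differential of \<open>g\<close> with denominator
  \<open>\<Delta>\<close>.\<close>

lemma dependent_on_differential:
  assumes "dependent_on fs g" "dual_frame fs (length fs) X \<Delta>"
  shows "\<Delta> * pderiv_mp v g = (\<Sum>j<length fs. vf (X j) g * pderiv_mp v (fs ! j))"
proof -
  have "\<forall>f\<in>set fs. vf (normal_part fs (length fs) X \<Delta> v) f = 0"
    using vf_normal_part_eq_0[OF assms(2)] by (auto simp: in_set_conv_nth)
  then have "vf (normal_part fs (length fs) X \<Delta> v) g = 0"
    using assms(1) by (simp add: dependent_on_def)
  then show ?thesis
    by (simp add: vf_normal_part mult.commute)
qed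

lemma vf_differential:
  assumes "\<And>v. \<Delta> * pderiv_mp v g = (\<Sum>j<s. a j * pderiv_mp v (fs ! j))"
  shows "\<Delta> * vf Y g = (\<Sum>j<s. a j * vf Y (fs ! j))"
proof -
  have "\<Delta> * vf Y g = (\<Sum>v\<in>UNIV. Y v * (\<Delta> * pderiv_mp v g))"
    by (simp add: vf_def sum_distrib_left mult_ac)
  also have "\<dots> = (\<Sum>j<s. a j * vf Y (fs ! j))"
    unfolding assms vf_def sum_distrib_left by (subst sum.swap) (simp add: mult_ac)
  finally show ?thesis .
qed

lemma dependent_onI:
  assumes "\<And>v. pderiv_mp v g = (\<Sum>j<length fs. a j * pderiv_mp v (fs ! j))"
  shows "dependent_on fs g"
  using vf_differential[of 1 g a fs "length fs"] assms by (auto simp: dependent_on_def)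

text \<open>If \<open>D\<close> kills all \<open>f\<^sub>i\<close> then \<open>D (X\<^sub>j g) = [D, X\<^sub>j] g\<close>, and
  \<open>[D, X\<^sub>j] f\<^sub>i = \<delta>\<^sub>i\<^sub>j D \<Delta>\<close>.\<close>
lemma dependent_on_coefficient:
  fixes fs :: "('v::finite, 'k::field_char_0) mpol list"
  assumes dg: "\<And>v. pderiv_mp v g = (\<Sum>j<length fs. a j * pderiv_mp v (fs ! j))"
    and frame: "dual_frame fs (length fs) X \<Delta>" "\<Delta> \<noteq> 0" and j: "j < length fs"
  shows "dependent_on fs (a j)"
  unfolding dependent_on_def
proof (intro allI impI)
  fix D :: "'v \<Rightarrow> ('v, 'k) mpol"
  assume D: "\<forall>f\<in>set fs. vf D f = 0"
  let ?s = "length fs"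
  let ?Z = "\<lambda>v. vf D (X j v) - vf (X j) (D v)"
  have dg': "vf Y g = (\<Sum>i<?s. a i * vf Y (fs ! i))" for Y
    using vf_differential[of 1 g a fs ?s Y] dg by simp
  have frame': "vf (X j) (fs ! i) = (if i = j then \<Delta> else 0)" if "i < ?s" for i
    using frame j that by (auto simp: dual_frame_def)
  have Dg: "vf D g = 0"
    using D by (simp add: dg')
  have "vf ?Z (fs ! i) = (if i = j then vf D \<Delta> else 0)" if "i < ?s" for i
    using D that by (simp add: vf_bracket[symmetric] frame')
  then have "vf ?Z g = (\<Sum>i<?s. if i = j then a i * vf D \<Delta> else 0)"
    unfolding dg'[of ?Z] by (intro sum.cong) auto
  then have Z: "vf ?Z g = a j * vf D \<Delta>"
    using j by simp
  have "vf (X j) g = (\<Sum>i<?s. if i = j then a i * \<Delta> else 0)"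
    unfolding dg'[of "X j"] by (intro sum.cong) (auto simp: frame')
  then have "vf (X j) g = a j * \<Delta>"
    using j by simp
  \<comment> \<open>\<open>vf D (vf (X j) g)\<close> is computed once by the product rule and once
    by the bracket; the terms with \<open>vf D \<Delta>\<close> cancel.\<close>
  then have "vf D (a j) * \<Delta> + a j * vf D \<Delta> = a j * vf D \<Delta>"
    using vf_bracket[of D "X j" g] by (simp add: vf_mult Dg Z)
  then show "vf D (a j) = 0"
    using frame(2) by (simp add: mpol_no_zero_div)
qed

subsection \<open>Weights\<close>

lemma lookup_const_mult: "lookup (const_mp c * p) m = c * lookup p m"
  for c :: "'k::comm_ring_1"
proof -
  have "const_mp c * p = (\<Sum>n\<in>keys p. single n (c * lookup p n))"
    by (subst (1) sum_single_keys[of p, symmetric])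
       (simp add: sum_distrib_left const_mp_def mult_single)
  then show ?thesis
    by (auto simp: lookup_sum lookup_single when_def sum.delta in_keys_iff)
qed

text \<open>Multiplying the derivative by its variable gives an operator that is diagonal on
  monomials. It preserves weights, and the truncated exponent disappears.\<close>

lemma var_pderiv_mp:
  "var_mp v * pderiv_mp v p = (\<Sum>m\<in>keys p. single m (of_nat (lookup m v) * lookup p m))"
proof -
  have "single (single v 1 + (m - single v 1)) (of_nat (lookup m v) * lookup p m)
      = single m (of_nat (lookup m v) * lookup p m)" for m
    by (cases "lookup m v = 0") (simp_all add: diff_single_add add.commute[of "single v (Suc 0)"])
  then show ?thesis
    by (simp add: var_mp_def pderiv_mp_def sum_distrib_left mult_single)
qed

lemma lookup_var_pderiv_mp:
  "lookup (var_mp v * pderiv_mp v p) m = of_nat (lookup m v) * lookup p m"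
  unfolding var_pderiv_mp
  by (auto simp: lookup_sum lookup_single when_def sum.delta in_keys_iff)

definition weight :: "('v::finite \<Rightarrow> nat) \<Rightarrow> ('v \<Rightarrow>\<^sub>0 nat) \<Rightarrow> nat" where
  "weight w m = (\<Sum>v\<in>UNIV. w v * lookup m v)"

lemma weight_add: "weight w (m + n) = weight w m + weight w n"
  by (simp add: weight_def lookup_add distrib_left sum.distrib)

text \<open>The weight is explicit, in contrast to \<open>homogeneous_mp\<close>; the zero
  polynomial is homogeneous of every weight.\<close>

definition homog :: "('v::finite \<Rightarrow> nat) \<Rightarrow> nat \<Rightarrow> ('v, 'k::zero) mpol \<Rightarrow> bool" where
  "homog w d p \<longleftrightarrow> (\<forall>m\<in>keys p. weight w m = d)"

lemma homog_mult:
  assumes "homog w d p" "homog w e q"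
  shows "homog w (d + e) (p * q)"
  using assms keys_mult[of p q] by (fastforce simp: homog_def weight_add)

lemma homog_var_pderiv_mp: "homog w d p \<Longrightarrow> homog w d (var_mp v * pderiv_mp v p)"
  by (auto simp: homog_def in_keys_iff lookup_var_pderiv_mp)

text \<open>With positive weights only the trivial monomial has weight 0. This is the base of the
  induction on weights and also the reason why the generators have positive weight.\<close>

lemma homog_0_const:
  assumes "homog w 0 p" "\<forall>v. w v > 0"
  shows "p = const_mp (lookup p 0)"
proof (rule poly_mapping_eqI)
  fix m
  have "m = 0" if "m \<in> keys p"
  proof (rule poly_mapping_eqI)
    fix v
    have "w v * lookup m v = 0"
      using that assms(1) by (simp add: homog_def weight_def)
    then show "lookup m v = lookup 0 v"
      using assms(2) by (metis lookup_zero mult_is_0 not_gr_zero)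
  qed
  then show "lookup p m = lookup (const_mp (lookup p 0)) m"
    by (auto simp: const_mp_def lookup_single when_def in_keys_iff)
qed

definition comp_mp :: "('v::finite \<Rightarrow> nat) \<Rightarrow> nat \<Rightarrow> ('v, 'k::comm_ring_1) mpol \<Rightarrow> ('v, 'k) mpol" where
  "comp_mp w d p = (\<Sum>m | m \<in> keys p \<and> weight w m = d. single m (lookup p m))"

lemma lookup_comp_mp: "lookup (comp_mp w d p) m = (if weight w m = d then lookup p m else 0)"
  by (auto simp: comp_mp_def lookup_sum lookup_single when_def sum.delta in_keys_iff)

lemma comp_mp_sum: "comp_mp w d (\<Sum>i\<in>A. f i) = (\<Sum>i\<in>A. comp_mp w d (f i))"
  by (rule poly_mapping_eqI) (simp add: lookup_comp_mp lookup_sum)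

lemma homog_comp_mp: "homog w d (comp_mp w d p)"
  by (auto simp: homog_def in_keys_iff lookup_comp_mp split: if_splits)

lemma comp_mp_homog:
  assumes "homog w d p"
  shows "comp_mp w e p = (if e = d then p else 0)"
  using assms by (intro poly_mapping_eqI) (auto simp: lookup_comp_mp homog_def in_keys_iff)

lemma comp_mp_var_pderiv: "comp_mp w d (var_mp v * pderiv_mp v p) = var_mp v * pderiv_mp v (comp_mp w d p)"
  by (rule poly_mapping_eqI) (simp add: lookup_comp_mp lookup_var_pderiv_mp)

text \<open>By linearity \<open>a\<close> may be taken as a monomial, so that the product is
  homogeneous. The case \<open>d > e\<close>, where the component is 0, is separate because
  \<open>e - d\<close> is truncated.\<close>

lemma comp_mp_mult:
  assumes "homog w d f"
  shows "comp_mp w e (a * f) = (if d \<le> e then comp_mp w (e - d) a * f else 0)"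
proof -
  have single: "comp_mp w e (single m c * f) = (if d \<le> e then comp_mp w (e - d) (single m c) * f else 0)" for m c
  proof -
    have 1: "homog w (weight w m) (single m c)"
      by (cases "c = 0") (auto simp: homog_def)
    show ?thesis
      unfolding comp_mp_homog[OF homog_mult[OF 1 assms]] comp_mp_homog[OF 1] by auto
  qed
  let ?S = "\<Sum>m\<in>keys a. single m (lookup a m)"
  have "comp_mp w e (?S * f) = (if d \<le> e then comp_mp w (e - d) ?S * f else 0)"
    by (simp add: sum_distrib_right comp_mp_sum single)
  then show ?thesis
    by (simp add: sum_single_keys)
qed

lemma sum_comp_mp: "p = (\<Sum>d\<in>weight w ` keys p. comp_mp w d p)"
proof (rule poly_mapping_eqI)
  fix m
  show "lookup p m = lookup (\<Sum>d\<in>weight w ` keys p. comp_mp w d p) m"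
    by (cases "m \<in> keys p") (auto simp: lookup_sum lookup_comp_mp sum.delta in_keys_iff)
qed

lemma euler_identity:
  fixes p :: "('v::finite, 'k::comm_ring_1) mpol"
  assumes "homog w d p"
  shows "(\<Sum>v\<in>UNIV. of_nat (w v) * (var_mp v * pderiv_mp v p)) = of_nat d * p"
proof (rule poly_mapping_eqI)
  fix m
  have "lookup (\<Sum>v\<in>UNIV. of_nat (w v) * (var_mp v * pderiv_mp v p)) m
      = of_nat (weight w m) * lookup p m"
    unfolding const_mp_of_nat[symmetric] lookup_sum lookup_const_mult lookup_var_pderiv_mp weight_def
    by (simp add: sum_distrib_right mult.assoc)
  also have "\<dots> = lookup (of_nat d * p) m"
    using assms unfolding const_mp_of_nat[symmetric] lookup_const_mult
    by (cases "m \<in> keys p") (auto simp: homog_def in_keys_iff)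
  finally show "lookup (\<Sum>v\<in>UNIV. of_nat (w v) * (var_mp v * pderiv_mp v p)) m = lookup (of_nat d * p) m" .
qed

lemma var_mp_neq_0: "var_mp v \<noteq> (0 :: ('v, 'k::comm_ring_1) mpol)"
proof
  assume "var_mp v = (0 :: ('v, 'k) mpol)"
  from arg_cong[OF this, of "\<lambda>p. lookup p (single v 1)"] show False
    by (simp add: var_mp_def)
qed

text \<open>Multiplication by \<open>var_mp v\<close> turns derivatives into weight-preserving
  operators; then components are taken and the variable is cancelled.\<close>

lemma comp_mp_differential:
  fixes fs :: "('v::finite, 'k::field_char_0) mpol list"
  assumes dg: "\<And>v. pderiv_mp v g = (\<Sum>j<s. a j * pderiv_mp v (fs ! j))"
    and hom: "\<And>j. j < s \<Longrightarrow> homog w (d j) (fs ! j)"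
  shows "pderiv_mp v (comp_mp w e g)
    = (\<Sum>j<s. (if d j \<le> e then comp_mp w (e - d j) (a j) else 0) * pderiv_mp v (fs ! j))"
proof -
  have "var_mp v * pderiv_mp v (comp_mp w e g) = comp_mp w e (var_mp v * pderiv_mp v g)"
    by (simp add: comp_mp_var_pderiv)
  also have "\<dots> = (\<Sum>j<s. comp_mp w e (a j * (var_mp v * pderiv_mp v (fs ! j))))"
    unfolding dg sum_distrib_left comp_mp_sum by (simp only: mult.left_commute)
  also have "\<dots> = var_mp v * (\<Sum>j<s. (if d j \<le> e then comp_mp w (e - d j) (a j) else 0) * pderiv_mp v (fs ! j))"
    unfolding sum_distrib_left
    by (intro sum.cong refl, subst comp_mp_mult[OF homog_var_pderiv_mp[OF hom]]) (auto simp: mult_ac)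
  finally show ?thesis
    by (rule mpol_mult_cancel_left) (rule var_mp_neq_0)
qed

subsection \<open>Zariski topology\<close>

lemma zariski_closed_zeros: "zariski_closed {\<xi>. eval_mp p \<xi> = 0}"
  unfolding zariski_closed_def by (intro exI[of _ "{p}"]) simp

lemma zariski_closed_separate:
  assumes "zariski_closed A" "\<not> W \<subseteq> A"
  obtains p \<xi> where "\<And>\<eta>. \<eta> \<in> A \<Longrightarrow> eval_mp p \<eta> = 0" "\<xi> \<in> W" "eval_mp p \<xi> \<noteq> 0"
proof -
  obtain S where S: "A = {\<xi>. \<forall>p\<in>S. eval_mp p \<xi> = 0}"
    using assms(1) unfolding zariski_closed_def by blast
  obtain \<xi> where "\<xi> \<in> W" "\<xi> \<notin> A"
    using assms(2) by blast
  with S obtain p where "p \<in> S" "eval_mp p \<xi> \<noteq> 0"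
    by blast
  with S \<open>\<xi> \<in> W\<close> show ?thesis
    by (intro that[of p \<xi>]) auto
qed

text \<open>If neither closed set contains \<open>W\<close>, each is cut out by a polynomial not
  vanishing on \<open>W\<close>, yet the product vanishes on \<open>W\<close>. Thus primality of the
  vanishing ideal suffices.\<close>

lemma zariski_irreducibleI:
  fixes W :: "('v::finite \<Rightarrow> 'k::comm_ring_1) set"
  assumes "W \<noteq> {}" "zariski_closed W"
    and prime: "\<And>p q. \<forall>\<xi>\<in>W. eval_mp (p * q) \<xi> = 0 \<Longrightarrow>
      (\<forall>\<xi>\<in>W. eval_mp p \<xi> = 0) \<or> (\<forall>\<xi>\<in>W. eval_mp q \<xi> = 0)"
  shows "zariski_irreducible W"
  unfolding zariski_irreducible_def
proof (intro conjI allI impI)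
  fix A B :: "('v \<Rightarrow> 'k) set"
  assume *: "zariski_closed A \<and> zariski_closed B \<and> W \<subseteq> A \<union> B"
  show "W \<subseteq> A \<or> W \<subseteq> B"
  proof (rule ccontr)
    assume "\<not> (W \<subseteq> A \<or> W \<subseteq> B)"
    then obtain p q \<xi> \<eta> where p: "\<And>\<zeta>. \<zeta> \<in> A \<Longrightarrow> eval_mp p \<zeta> = 0" "\<xi> \<in> W" "eval_mp p \<xi> \<noteq> 0"
      and q: "\<And>\<zeta>. \<zeta> \<in> B \<Longrightarrow> eval_mp q \<zeta> = 0" "\<eta> \<in> W" "eval_mp q \<eta> \<noteq> 0"
      using * zariski_closed_separate by meson
    then have "\<forall>\<xi>\<in>W. eval_mp (p * q) \<xi> = 0"
      using * by auto
    with prime p q show False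
      by blast
  qed
qed (fact assms)+

lemma zariski_irreducible_mult:
  fixes p q :: "('v::finite, 'k::idom) mpol"
  assumes "zariski_irreducible V" "\<And>\<xi>. \<xi> \<in> V \<Longrightarrow> eval_mp (p * q) \<xi> = 0"
  shows "(\<forall>\<xi>\<in>V. eval_mp p \<xi> = 0) \<or> (\<forall>\<xi>\<in>V. eval_mp q \<xi> = 0)"
proof -
  have "V \<subseteq> {\<xi>. eval_mp p \<xi> = 0} \<union> {\<xi>. eval_mp q \<xi> = 0}"
    using assms(2) by auto
  then have "V \<subseteq> {\<xi>. eval_mp p \<xi> = 0} \<or> V \<subseteq> {\<xi>. eval_mp q \<xi> = 0}"
    using assms(1) zariski_closed_zeros unfolding zariski_irreducible_def by blast
  then show ?thesis
    by blast
qed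

lemma zariski_irreducible_power:
  fixes p :: "('v::finite, 'k::idom) mpol"
  assumes "zariski_irreducible V" "\<And>\<xi>. \<xi> \<in> V \<Longrightarrow> eval_mp (p ^ n * q) \<xi> = 0"
  shows "(\<forall>\<xi>\<in>V. eval_mp p \<xi> = 0) \<or> (\<forall>\<xi>\<in>V. eval_mp q \<xi> = 0)"
  using zariski_irreducible_mult[OF assms] by auto

lemma zariski_irreducible_UNIV: "zariski_irreducible (UNIV :: ('v::finite \<Rightarrow> 'k::field_char_0) set)"
proof (rule zariski_irreducibleI)
  show "zariski_closed (UNIV :: ('v \<Rightarrow> 'k) set)"
    unfolding zariski_closed_def by (intro exI[of _ "{}"]) simp
  fix p q :: "('v, 'k) mpol"
  assume "\<forall>\<xi>\<in>UNIV. eval_mp (p * q) \<xi> = 0"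
  then have "p * q = 0"
    by (intro eval_mp_eq_0D) auto
  then show "(\<forall>\<xi>\<in>UNIV. eval_mp p \<xi> = 0) \<or> (\<forall>\<xi>\<in>UNIV. eval_mp q \<xi> = 0)"
    by (auto simp: mpol_no_zero_div)
qed simp

text \<open>The whole space is irreducible, and no set is strictly larger. This supplies a point
  outside the Jacobian locus.\<close>

lemma codim_ge_2_neq_UNIV:
  fixes J :: "('v::finite \<Rightarrow> 'k::field_char_0) set"
  assumes "codim_ge_2 J"
  shows "J \<noteq> UNIV"
  using assms zariski_irreducible_UNIV unfolding codim_ge_2_def by blast

subsection \<open>Division along a direction\<close>

lemma coeff_pcompose_shift:
  fixes P :: "'a::idom poly"
  assumes "degree P \<le> n"
  shows "coeff (pcompose P [:r, 1:]) n = coeff P n"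
proof (cases "degree P = n")
  case True
  then show ?thesis
    using lead_coeff_comp[of "[:r, 1:]" P] by (simp add: degree_pcompose)
next
  case False
  then have "degree P < n"
    using assms by simp
  then show ?thesis
    by (simp add: coeff_eq_0 degree_pcompose)
qed

locale direction =
  fixes c :: "'v::finite \<Rightarrow> 'k::{alg_closed_field, field_char_0}" and v0 :: 'v
  assumes v0: "c v0 \<noteq> 0"
begin

text \<open>In linear coordinates with \<open>c\<close> along an axis, this is the degree in that
  coordinate, and \<open>lcoef\<close> is the leading coefficient. Degree 0 means constant along
  \<open>c\<close>.\<close>

definition ldeg :: "('v, 'k) mpol \<Rightarrow> nat" where
  "ldeg p = degree (shift_mp c p)"

definition lcoef :: "('v, 'k) mpol \<Rightarrow> ('v, 'k) mpol" where
  "lcoef p = coeff (shift_mp c p) (ldeg p)"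

lemma shift_eq_0: "shift_mp c p = 0 \<longleftrightarrow> p = 0"
  by (metis poly_shift_0 poly_0 shift_simps(4))

lemma lcoef_eq_0: "lcoef p = 0 \<longleftrightarrow> p = 0"
  by (simp add: lcoef_def ldeg_def shift_eq_0)

lemma ldeg_0 [simp]: "ldeg 0 = 0"
  by (simp add: ldeg_def)

lemma ldeg_1 [simp]: "ldeg 1 = 0"
  by (simp add: ldeg_def)

lemma ldeg_mult:
  assumes "p \<noteq> 0" "q \<noteq> 0"
  shows "ldeg (p * q) = ldeg p + ldeg q"
proof (rule antisym)
  show "ldeg (p * q) \<le> ldeg p + ldeg q"
    by (simp add: ldeg_def degree_mult_le)
  have "coeff (shift_mp c (p * q)) (ldeg p + ldeg q) = lcoef p * lcoef q"
    by (simp add: lcoef_def ldeg_def coeff_mult_degree_sum)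
  then have "coeff (shift_mp c (p * q)) (ldeg p + ldeg q) \<noteq> 0"
    using assms by (simp add: mpol_no_zero_div lcoef_eq_0)
  then show "ldeg p + ldeg q \<le> ldeg (p * q)"
    unfolding ldeg_def[of "p * q"] by (rule le_degree)
qed

lemma ldeg_dvd_le:
  assumes "p dvd q" "q \<noteq> 0"
  shows "ldeg p \<le> ldeg q"
proof -
  obtain k where "q = p * k"
    using assms(1) by blast
  moreover have "p \<noteq> 0" "k \<noteq> 0"
    using assms(2) calculation by auto
  ultimately show ?thesis
    by (simp add: ldeg_mult)
qed

lemma ldeg_power: "ldeg p = 0 \<Longrightarrow> ldeg (p ^ n) = 0"
proof (induction n)
  case (Suc n)
  then show ?case
    by (cases "p = 0") (simp_all add: ldeg_mult)
qed simp

lemma eval_ldeg_0: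
  assumes "ldeg b = 0"
  shows "eval_mp b (\<lambda>v. \<xi> v + s * c v) = eval_mp b \<xi>"
proof -
  obtain a where a: "shift_mp c b = [:a:]"
    using assms degree_eq_zeroE unfolding ldeg_def by blast
  then have "a = b"
    using poly_shift_0[of c b] by simp
  then show ?thesis
    using eval_poly_shift[of c b s \<xi>] a by simp
qed

lemma ldeg_0I:
  assumes "\<And>\<xi> s. eval_mp b (\<lambda>v. \<xi> v + s * c v) = eval_mp b \<xi>"
  shows "ldeg b = 0"
proof -
  have "coeff (shift_mp c b) i = 0" if "i > 0" for i
  proof (rule eval_mp_eq_0D)
    fix \<xi>
    have "poly (line_mp \<xi> c b) = poly [:eval_mp b \<xi>:]"
      by (rule ext) (simp add: poly_line assms)
    then have "line_mp \<xi> c b = [:eval_mp b \<xi>:]"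
      by (simp add: poly_eq_poly_eq_iff)
    then show "eval_mp (coeff (shift_mp c b) i) \<xi> = 0"
      using coeff_line[of \<xi> c b i] that by (cases i) auto
  qed
  then show ?thesis
    unfolding ldeg_def by (intro le_antisym degree_le) auto
qed

text \<open>Moving the base point along \<open>c\<close> translates the parameter of the line, which
  leaves the top coefficient of the restriction unchanged.\<close>

lemma ldeg_lcoef: "ldeg (lcoef p) = 0"
proof (rule ldeg_0I)
  fix \<xi> :: "'v \<Rightarrow> 'k" and r
  have "poly (line_mp (\<lambda>v. \<xi> v + r * c v) c p) = poly (pcompose (line_mp \<xi> c p) [:r, 1:])"
    by (rule ext) (simp add: poly_line poly_pcompose algebra_simps)
  then have line: "line_mp (\<lambda>v. \<xi> v + r * c v) c p = pcompose (line_mp \<xi> c p) [:r, 1:]"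
    by (simp add: poly_eq_poly_eq_iff)
  have "degree (line_mp \<xi> c p) \<le> ldeg p"
    by (intro degree_le) (auto simp: coeff_line ldeg_def coeff_eq_0)
  then show "eval_mp (lcoef p) (\<lambda>v. \<xi> v + r * c v) = eval_mp (lcoef p) \<xi>"
    unfolding lcoef_def coeff_line[symmetric] line by (rule coeff_pcompose_shift)
qed

text \<open>A linear form that grows by \<open>s\<close> when a point moves by \<open>s\<close>
  times \<open>c\<close>; its powers play the role of powers of the main variable in
  division.\<close>

definition slice :: "('v, 'k) mpol" where
  "slice = const_mp (inverse (c v0)) * var_mp v0"

lemma shift_slice: "shift_mp c slice = [:slice, 1:]"
  using v0 by (simp add: slice_def mult.commute[of "const_mp (inverse _)"])

lemma ldeg_slice: "ldeg slice = 1" "slice \<noteq> 0"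
  using shift_slice by (auto simp: ldeg_def)

lemma lcoef_slice: "lcoef slice = 1"
  using ldeg_slice by (simp add: lcoef_def shift_slice)

lemma lcoef_mult:
  assumes "p \<noteq> 0" "q \<noteq> 0"
  shows "lcoef (p * q) = lcoef p * lcoef q"
  using coeff_mult_degree_sum[of "shift_mp c p" "shift_mp c q"]
  by (simp add: lcoef_def ldeg_mult[OF assms]) (simp add: ldeg_def)

lemma lcoef_ldeg_0:
  assumes "ldeg b = 0"
  shows "lcoef b = b"
  using poly_shift_0[of c b] assms by (simp add: lcoef_def ldeg_def poly_0_coeff_0)

lemma ldeg_slice_power: "ldeg (slice ^ n) = n" "lcoef (slice ^ n) = 1"
  by (induction n) (simp_all add: ldeg_mult lcoef_mult ldeg_slice lcoef_slice lcoef_ldeg_0)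

lemma ldeg_diff_less:
  assumes "ldeg p = n" "ldeg q = n" "lcoef p = lcoef q"
  shows "p - q = 0 \<or> ldeg (p - q) < n"
proof -
  have "degree (shift_mp c (p - q)) \<le> n"
    using assms(1,2) by (simp add: ldeg_def degree_diff_le)
  moreover have "coeff (shift_mp c (p - q)) n = 0"
    using assms by (simp add: lcoef_def)
  ultimately show ?thesis
    by (metis ldeg_def leading_coeff_0_iff le_neq_implies_less shift_eq_0)
qed

lemma pseudo_division:
  assumes "q \<noteq> 0"
  shows "\<exists>N u r. lcoef q ^ N * p = q * u + r \<and> (r = 0 \<or> ldeg r < ldeg q)"
\<comment> \<open>The measure places 0 strictly below the nonzero polynomials of \<open>ldeg\<close>
  0.\<close>
proof (induction "if p = 0 then 0 else Suc (ldeg p)" arbitrary: p rule: less_induct)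
  case less
  show ?case
  proof (cases "p = 0 \<or> ldeg p < ldeg q")
    case True
    then show ?thesis
      by (intro exI[of _ 0] exI[of _ p]) simp
  next
    case False
    define k where "k = ldeg p - ldeg q"
    \<comment> \<open>Both products have degree \<open>ldeg p\<close> and leading coefficient
      \<open>lcoef p * lcoef q\<close>, so the difference drops in degree.\<close>
    define p' where "p' = lcoef q * p - lcoef p * slice ^ k * q"
    have nz: "p \<noteq> 0" "slice ^ k \<noteq> 0" "lcoef p \<noteq> 0" "lcoef q \<noteq> 0"
      using False assms ldeg_slice(2) by (simp_all add: lcoef_eq_0)
    have "p' = 0 \<or> ldeg p' < ldeg p"
      unfolding p'_def
      by (rule ldeg_diff_less)
         (use nz False assms in \<open>simp_all add: k_def ldeg_mult lcoef_mult mpol_no_zero_div ldeg_lcoef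
            lcoef_ldeg_0 ldeg_slice_power\<close>)
    then have "(if p' = 0 then 0 else Suc (ldeg p')) < (if p = 0 then 0 else Suc (ldeg p))"
      using nz by auto
    from less[OF this] obtain N u r where
      *: "lcoef q ^ N * p' = q * u + r" "r = 0 \<or> ldeg r < ldeg q"
      by blast
    have "lcoef q ^ Suc N * p = lcoef q ^ N * p' + q * (lcoef q ^ N * lcoef p * slice ^ k)"
      by (simp add: p'_def algebra_simps)
    also have "\<dots> = q * (u + lcoef q ^ N * lcoef p * slice ^ k) + r"
      unfolding *(1) by (simp add: algebra_simps)
    finally show ?thesis
      using *(2) by blast
  qed
qed

text \<open>The pseudo-remainder \<open>r\<close> satisfies \<open>q dvd b * r\<close>, and
  \<open>ldeg (b * r)\<close> is too small unless \<open>r = 0\<close>. So every denominator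
  \<open>b\<close> can be traded for a power of \<open>lcoef q\<close>.\<close>

lemma dvd_pseudo:
  assumes "q \<noteq> 0" "b \<noteq> 0" "ldeg b = 0" "q dvd b * p"
  shows "\<exists>N. q dvd lcoef q ^ N * p"
proof -
  obtain N u r where *: "lcoef q ^ N * p = q * u + r" "r = 0 \<or> ldeg r < ldeg q"
    using pseudo_division[OF assms(1)] by blast
  have "q dvd b * (lcoef q ^ N * p)"
    using assms(4) by (metis dvd_mult mult.left_commute)
  then have "q dvd b * r"
    unfolding *(1) distrib_left by (simp add: dvd_add_right_iff)
  have "r = 0"
  proof (rule ccontr)
    assume "r \<noteq> 0"
    then have "ldeg q \<le> ldeg b + ldeg r"
      using ldeg_dvd_le[OF \<open>q dvd b * r\<close>] assms by (simp add: mpol_no_zero_div ldeg_mult)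
    then show False
      using * \<open>r \<noteq> 0\<close> assms by simp
  qed
  then show ?thesis
    using *(1) by (intro exI[of _ N]) simp
qed

text \<open>Divisibility after inverting the nonzero elements that are constant along \<open>c\<close>.\<close>
definition ldvd :: "('v, 'k) mpol \<Rightarrow> ('v, 'k) mpol \<Rightarrow> bool" where
  "ldvd p h \<longleftrightarrow> (\<exists>b. b \<noteq> 0 \<and> ldeg b = 0 \<and> p dvd b * h)"

lemma ldvdI: "b \<noteq> 0 \<Longrightarrow> ldeg b = 0 \<Longrightarrow> p dvd b * h \<Longrightarrow> ldvd p h"
  by (auto simp: ldvd_def)

lemma dvd_imp_ldvd: "p dvd h \<Longrightarrow> ldvd p h"
  by (rule ldvdI[of 1]) auto

lemma ldvd_trans:
  assumes "ldvd p q" "ldvd q r"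
  shows "ldvd p r"
proof -
  obtain a b where ab: "a \<noteq> 0" "ldeg a = 0" "p dvd a * q" "b \<noteq> 0" "ldeg b = 0" "q dvd b * r"
    using assms by (auto simp: ldvd_def)
  then have "p dvd a * (b * r)"
    by (meson dvd_refl dvd_trans mult_dvd_mono)
  then show ?thesis
    using ab by (intro ldvdI[of "a * b"]) (auto simp: mpol_no_zero_div ldeg_mult mult.assoc)
qed

lemma ldvd_add:
  assumes "ldvd p q" "ldvd p r"
  shows "ldvd p (q + r)"
proof -
  obtain a b where ab: "a \<noteq> 0" "ldeg a = 0" "p dvd a * q" "b \<noteq> 0" "ldeg b = 0" "p dvd b * r"
    using assms by (auto simp: ldvd_def)
  have "p dvd b * (a * q) + a * (b * r)"
    using ab by (intro dvd_add) (auto intro: dvd_mult)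
  also have "\<dots> = (a * b) * (q + r)"
    by (simp add: algebra_simps)
  finally show ?thesis
    using ab by (intro ldvdI[of "a * b"]) (auto simp: mpol_no_zero_div ldeg_mult)
qed

lemma ldvd_mult: "ldvd p q \<Longrightarrow> ldvd p (a * q)"
  by (rule ldvd_trans) (auto intro: dvd_imp_ldvd)

lemma ldvd_cancel:
  assumes "ldvd p (b * h)" "b \<noteq> 0" "ldeg b = 0"
  shows "ldvd p h"
proof -
  obtain a where a: "a \<noteq> 0" "ldeg a = 0" "p dvd a * (b * h)"
    using assms(1) by (auto simp: ldvd_def)
  then show ?thesis
    using assms by (intro ldvdI[of "a * b"]) (auto simp: mpol_no_zero_div ldeg_mult mult.assoc)
qed

lemma ldvd_ldeg_le:
  assumes "ldvd p h" "h \<noteq> 0"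
  shows "ldeg p \<le> ldeg h"
proof -
  obtain b where b: "b \<noteq> 0" "ldeg b = 0" "p dvd b * h"
    using assms(1) by (auto simp: ldvd_def)
  then have "ldeg p \<le> ldeg (b * h)"
    using assms by (intro ldeg_dvd_le) (auto simp: mpol_no_zero_div)
  then show ?thesis
    using b assms by (simp add: ldeg_mult)
qed

text \<open>An element of least \<open>ldeg\<close> works: pseudo-remainders modulo it stay in
  \<open>I\<close> and hence vanish. This is the Euclidean argument in the localized ring.\<close>

lemma ideal_generator:
  assumes add: "\<And>a b. a \<in> I \<Longrightarrow> b \<in> I \<Longrightarrow> a + b \<in> I" and mult: "\<And>a b. a \<in> I \<Longrightarrow> b * a \<in> I"
    and ne: "q \<in> I" "q \<noteq> 0"
  obtains h where "h \<in> I" "h \<noteq> 0" "\<And>a. a \<in> I \<Longrightarrow> ldvd h a"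
proof -
  obtain h where h: "h \<in> I \<and> h \<noteq> 0" and min: "\<And>a. a \<in> I \<and> a \<noteq> 0 \<Longrightarrow> ldeg h \<le> ldeg a"
    using ex_has_least_nat[of "\<lambda>h. h \<in> I \<and> h \<noteq> 0" q ldeg] ne by blast
  have "ldvd h a" if "a \<in> I" for a
  proof -
    obtain N u r where *: "lcoef h ^ N * a = h * u + r" "r = 0 \<or> ldeg r < ldeg h"
      using pseudo_division h by blast
    have "r = lcoef h ^ N * a + (- u) * h"
      using *(1) by (simp add: algebra_simps)
    also have "\<dots> \<in> I"
      using that h by (intro add mult) auto
    finally have "r = 0"
      using *(2) min[of r] by fastforce
    then show ?thesis
      using * h by (intro ldvdI[of "lcoef h ^ N"]) (auto simp: lcoef_eq_0 ldeg_lcoef ldeg_power)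
  qed
  then show ?thesis
    using h by (intro that) auto
qed

text \<open>Where \<open>lcoef p\<close> does not vanish, the restriction to the line keeps positive
  degree and has a root in the algebraically closed field.\<close>

lemma root_on_line:
  assumes "ldeg p > 0" "eval_mp (lcoef p) \<xi> \<noteq> 0"
  obtains s where "eval_mp p (\<lambda>v. \<xi> v + s * c v) = 0"
proof -
  have "coeff (line_mp \<xi> c p) (ldeg p) \<noteq> 0"
    using assms(2) by (simp add: coeff_line lcoef_def)
  then have "degree (line_mp \<xi> c p) \<ge> ldeg p"
    by (rule le_degree)
  then obtain s where "poly (line_mp \<xi> c p) s = 0"
    using alg_closed_imp_poly_has_root[of "line_mp \<xi> c p"] assms(1) by auto
  then show ?thesis
    using that by (simp add: poly_line)
qed

end

section \<open>The irreducible hypersurface of an irreducible element of the localized ring\<close>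

locale irreducible_direction = direction c v0
  for c :: "'v::finite \<Rightarrow> 'k::{alg_closed_field, field_char_0}" and v0 :: 'v +
  fixes \<pi> :: "('v, 'k) mpol"
  assumes pi_ldeg: "ldeg \<pi> > 0"
    and pi_irreducible: "\<And>d. ldvd d \<pi> \<Longrightarrow> ldeg d > 0 \<Longrightarrow> ldeg \<pi> \<le> ldeg d"
begin

lemma pi_nonzero: "\<pi> \<noteq> 0"
  using pi_ldeg by auto

text \<open>A generator \<open>r\<close> of the ideal of \<open>\<pi>\<close> and \<open>h\<close>
  divides \<open>\<pi>\<close>. If it had positive degree, irreducibility would give it at least the
  degree of \<open>\<pi>\<close>, making it associated to \<open>\<pi>\<close>, which then would
  divide \<open>h\<close>.\<close>

lemma bezout:
  assumes "\<not> ldvd \<pi> h"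
  obtains u w r where "u * \<pi> + w * h = r" "r \<noteq> 0" "ldeg r = 0"
proof -
  define I where "I = {u * \<pi> + w * h |u w. True}"
  have "1 * \<pi> + 0 * h \<in> I" "0 * \<pi> + 1 * h \<in> I"
    unfolding I_def by blast+
  then have pi: "\<pi> \<in> I" and h: "h \<in> I"
    by simp_all
  obtain r where r: "r \<in> I" "r \<noteq> 0" and gen: "\<And>a. a \<in> I \<Longrightarrow> ldvd r a"
  proof (rule ideal_generator[OF _ _ pi pi_nonzero])
    fix a b
    assume "a \<in> I"
    then obtain u w where a: "a = u * \<pi> + w * h"
      by (auto simp: I_def)
    have "b * a = (b * u) * \<pi> + (b * w) * h"
      by (simp add: a algebra_simps)
    then show "b * a \<in> I"
      unfolding I_def by blast
    assume "b \<in> I"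
    then obtain u' w' where "b = u' * \<pi> + w' * h"
      by (auto simp: I_def)
    then have "a + b = (u + u') * \<pi> + (w + w') * h"
      by (simp add: a algebra_simps)
    then show "a + b \<in> I"
      unfolding I_def by blast
  qed blast
  have "ldeg r = 0"
  proof (rule ccontr)
    assume "ldeg r \<noteq> 0"
    then have deg: "ldeg \<pi> \<le> ldeg r"
      using pi_irreducible gen[OF pi] by simp
    obtain b y where b: "b \<noteq> 0" "ldeg b = 0" "b * \<pi> = r * y"
      using gen[OF pi] by (auto simp: ldvd_def elim!: dvdE)
    have "y \<noteq> 0"
      using b pi_nonzero by (auto simp: mpol_no_zero_div)
    have "ldeg b + ldeg \<pi> = ldeg r + ldeg y"
      using b r \<open>y \<noteq> 0\<close> pi_nonzero by (metis ldeg_mult)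
    then have "ldeg y = 0"
      using deg b by simp
    have "y * r = b * \<pi>"
      using b(3) by (simp add: mult.commute)
    then have "ldvd \<pi> (y * r)"
      by (simp add: dvd_imp_ldvd)
    then have "ldvd \<pi> r"
      using \<open>y \<noteq> 0\<close> \<open>ldeg y = 0\<close> by (rule ldvd_cancel)
    then show False
      using assms gen[OF h] ldvd_trans by blast
  qed
  moreover obtain u w where "r = u * \<pi> + w * h"
    using r(1) by (auto simp: I_def)
  ultimately show ?thesis
    using that r(2) by simp
qed

lemma pi_prime:
  assumes "ldvd \<pi> (f * h)"
  shows "ldvd \<pi> f \<or> ldvd \<pi> h"
proof (rule disjCI)
  assume "\<not> ldvd \<pi> h"
  then obtain u w r where r: "u * \<pi> + w * h = r" "r \<noteq> 0" "ldeg r = 0"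
    by (rule bezout)
  have "r * f = (u * f) * \<pi> + w * (f * h)"
    unfolding r(1)[symmetric] by (simp add: algebra_simps)
  also have "ldvd \<pi> \<dots>"
    using assms by (intro ldvd_add ldvd_mult[OF assms] dvd_imp_ldvd) auto
  finally show "ldvd \<pi> f"
    using r(2,3) by (rule ldvd_cancel)
qed

text \<open>\<open>\<pi>\<close> may contain factors constant along \<open>c\<close>, whose zeros
  would be extra components. Imposing all multiples in the localized ring removes these
  components.\<close>

definition hypersurface :: "('v \<Rightarrow> 'k) set" where
  "hypersurface = {\<xi>. \<forall>h. ldvd \<pi> h \<longrightarrow> eval_mp h \<xi> = 0}"

text \<open>Otherwise Bezout gives a nonzero \<open>r\<close> constant along \<open>c\<close>. From
  a point where \<open>r\<close> and \<open>lcoef \<pi>\<close> are nonzero one moves along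
  \<open>c\<close> to a zero of \<open>\<pi>\<close>; both values persist. That zero lies on the
  hypersurface since denominators are powers of \<open>lcoef \<pi>\<close>, but there
  \<open>u * \<pi> + w * h\<close> is 0.\<close>

lemma hypersurface_nullstellensatz:
  "(\<forall>\<xi>\<in>hypersurface. eval_mp h \<xi> = 0) \<longleftrightarrow> ldvd \<pi> h"
proof
  assume zero: "\<forall>\<xi>\<in>hypersurface. eval_mp h \<xi> = 0"
  show "ldvd \<pi> h"
  proof (rule ccontr)
    assume "\<not> ldvd \<pi> h"
    then obtain u w r where r: "u * \<pi> + w * h = r" "r \<noteq> 0" "ldeg r = 0"
      by (rule bezout)
    define l where "l = lcoef \<pi>"
    have "r * l \<noteq> 0"
      using r pi_nonzero by (simp add: l_def mpol_no_zero_div lcoef_eq_0)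
    then obtain \<eta> where \<eta>: "eval_mp (r * l) \<eta> \<noteq> 0"
      by (rule ex_eval_mp_nonzero)
    then obtain s where s: "eval_mp \<pi> (\<lambda>v. \<eta> v + s * c v) = 0"
      using root_on_line[OF pi_ldeg, of \<eta>] by (auto simp: l_def)
    define \<zeta> where "\<zeta> = (\<lambda>v. \<eta> v + s * c v)"
    have r0: "eval_mp r \<zeta> \<noteq> 0" and l0: "eval_mp l \<zeta> \<noteq> 0"
      using \<eta> r by (simp_all add: \<zeta>_def eval_ldeg_0 l_def ldeg_lcoef)
    have "\<zeta> \<in> hypersurface"
      unfolding hypersurface_def
    proof (intro CollectI allI impI)
      fix f
      assume "ldvd \<pi> f"
      then obtain N where "\<pi> dvd l ^ N * f"
        using dvd_pseudo[OF pi_nonzero] by (auto simp: ldvd_def l_def)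
      then obtain k where "l ^ N * f = \<pi> * k"
        by blast
      then have "eval_mp (l ^ N * f) \<zeta> = 0"
        using s by (simp add: \<zeta>_def)
      then show "eval_mp f \<zeta> = 0"
        using l0 by simp
    qed
    then have "eval_mp (u * \<pi> + w * h) \<zeta> = 0"
      using zero s by (simp add: \<zeta>_def)
    then show False
      using r r0 by simp
  qed
qed (auto simp: hypersurface_def)

lemma not_ldvd_ldeg_0: "b \<noteq> 0 \<Longrightarrow> ldeg b = 0 \<Longrightarrow> \<not> ldvd \<pi> b"
  using ldvd_ldeg_le[of \<pi> b] pi_ldeg by auto

lemma hypersurface_irreducible: "zariski_irreducible hypersurface"
proof (rule zariski_irreducibleI)
  have "\<not> ldvd \<pi> 1"
    by (intro not_ldvd_ldeg_0) auto
  then show "hypersurface \<noteq> {}"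
    using hypersurface_nullstellensatz[of 1] by auto
  show "zariski_closed hypersurface"
    unfolding zariski_closed_def hypersurface_def by (intro exI[of _ "{h. ldvd \<pi> h}"]) simp
qed (use hypersurface_nullstellensatz pi_prime in blast)

text \<open>Each division by \<open>\<pi>\<close> lowers \<open>ldeg\<close>, so the process of
  extracting factors stops.\<close>

lemma split_power:
  assumes "h \<noteq> 0"
  obtains b e h' where "b \<noteq> 0" "b * h = \<pi> ^ e * h'" "\<not> ldvd \<pi> h'"
proof -
  have "\<exists>b e h'. b \<noteq> 0 \<and> b * h = \<pi> ^ e * h' \<and> \<not> ldvd \<pi> h'"
    using assms
  proof (induction "ldeg h" arbitrary: h rule: less_induct)
    case less
    show ?case
    proof (cases "ldvd \<pi> h")
      case True
      then obtain a k where a: "a \<noteq> 0" "ldeg a = 0" "a * h = \<pi> * k"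
        by (auto simp: ldvd_def elim!: dvdE)
      then have "k \<noteq> 0"
        using less.prems by (auto simp: mpol_no_zero_div)
      then have "ldeg a + ldeg h = ldeg \<pi> + ldeg k"
        using a less.prems pi_nonzero by (metis ldeg_mult)
      then have "ldeg k < ldeg h"
        using a pi_ldeg by simp
      from less.hyps[OF this \<open>k \<noteq> 0\<close>] obtain b e h' where
        b: "b \<noteq> 0" "b * k = \<pi> ^ e * h'" "\<not> ldvd \<pi> h'"
        by blast
      have "(a * b) * h = b * (a * h)"
        by (simp add: mult_ac)
      also have "\<dots> = \<pi> * (b * k)"
        using a by (simp add: mult_ac)
      also have "\<dots> = \<pi> ^ Suc e * h'"
        using b by (simp add: mult_ac)
      finally show ?thesis
        using a b by (metis mpol_no_zero_div)
    next
      case False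
      then show ?thesis
        by (intro exI[of _ 1] exI[of _ 0] exI[of _ h]) simp
    qed
  qed
  then show ?thesis
    using that by blast
qed

text \<open>A nonzero \<open>h\<close> vanishing on \<open>V\<close> is split as a power of
  \<open>\<pi>\<close> times \<open>h'\<close>. Since \<open>h'\<close> does not vanish on the
  hypersurface, irreducibility of \<open>V\<close> forces \<open>\<pi>\<close> to vanish on
  \<open>V\<close>, and the same argument, cancelling powers of \<open>lcoef \<pi>\<close>, forces
  all its multiples in the localized ring to vanish.\<close>

lemma hypersurface_maximal:
  assumes V: "zariski_irreducible V" "hypersurface \<subseteq> V" "V \<noteq> UNIV"
  shows "V \<subseteq> hypersurface"
proof -
  have nonvanishing: "\<not> (\<forall>\<xi>\<in>V. eval_mp h \<xi> = 0)" if "\<not> ldvd \<pi> h" for h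
    using that V(2) hypersurface_nullstellensatz[of h] by blast
  have "zariski_closed V" "\<not> UNIV \<subseteq> V"
    using V by (auto simp: zariski_irreducible_def)
  then obtain h \<xi> where h: "\<And>\<eta>. \<eta> \<in> V \<Longrightarrow> eval_mp h \<eta> = 0" "eval_mp h \<xi> \<noteq> 0"
    using zariski_closed_separate by metis
  then have "h \<noteq> 0"
    by auto
  then obtain b e h' where b: "b \<noteq> 0" "b * h = \<pi> ^ e * h'" "\<not> ldvd \<pi> h'"
    by (rule split_power)
  have "eval_mp (\<pi> ^ e * h') \<eta> = 0" if "\<eta> \<in> V" for \<eta>
    using h(1)[OF that] unfolding b(2)[symmetric] by simp
  then have pi: "\<forall>\<xi>\<in>V. eval_mp \<pi> \<xi> = 0"
    using zariski_irreducible_power[OF V(1)] nonvanishing[OF b(3)] by blast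
  have "\<forall>\<xi>\<in>V. eval_mp f \<xi> = 0" if f: "ldvd \<pi> f" for f
  proof -
    obtain N where "\<pi> dvd lcoef \<pi> ^ N * f"
      using f dvd_pseudo[OF pi_nonzero] by (auto simp: ldvd_def)
    then obtain k where k: "lcoef \<pi> ^ N * f = \<pi> * k"
      by blast
    have "eval_mp (lcoef \<pi> ^ N * f) \<eta> = 0" if "\<eta> \<in> V" for \<eta>
      using pi that unfolding k by simp
    moreover have "\<not> ldvd \<pi> (lcoef \<pi>)"
      using pi_nonzero by (intro not_ldvd_ldeg_0) (auto simp: lcoef_eq_0 ldeg_lcoef)
    ultimately show ?thesis
      using zariski_irreducible_power[OF V(1)] nonvanishing by blast
  qed
  then show ?thesis
    by (auto simp: hypersurface_def)
qed

text \<open>By maximality no irreducible set lies strictly between the hypersurface and the whole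
  space.\<close>

lemma hypersurface_not_subset:
  assumes "codim_ge_2 J"
  shows "\<not> hypersurface \<subseteq> J"
  using assms hypersurface_irreducible hypersurface_maximal unfolding codim_ge_2_def by blast

end

context direction
begin

text \<open>With a constant leading coefficient the denominators, powers of \<open>lcoef q\<close>,
  are units, so divisibility descends from the localized ring.\<close>

lemma dvd_of_ldvd:
  assumes "q \<noteq> 0" "lcoef q = const_mp k" "ldvd q p"
  shows "q dvd p"
proof -
  have "k \<noteq> 0"
    using assms(1,2) lcoef_eq_0[of q] by auto
  then have unit: "const_mp k * const_mp (inverse k) = (1 :: ('v, 'k) mpol)"
    by simp
  obtain N where "q dvd const_mp k ^ N * p"
    using dvd_pseudo[OF assms(1)] assms by (auto simp: ldvd_def)
  then have "q dvd const_mp (inverse k) ^ N * (const_mp k ^ N * p)"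
    by (rule dvd_mult)
  also have "\<dots> = (const_mp k * const_mp (inverse k)) ^ N * p"
    by (simp only: power_mult_distrib mult_ac)
  finally show ?thesis
    unfolding unit by simp
qed

text \<open>Otherwise an irreducible factor of the denominator of \<open>p / q\<close> would
  define a hypersurface inside \<open>J\<close>.\<close>
lemma ldvd_of_codim_ge_2:
  assumes "codim_ge_2 J" "q \<noteq> 0"
    and local: "\<And>\<xi>. \<xi> \<notin> J \<Longrightarrow> \<exists>p' q'. p * q' = p' * q \<and> eval_mp q' \<xi> \<noteq> 0"
  shows "ldvd q p"
proof (rule ccontr)
  assume not: "\<not> ldvd q p"
  \<comment> \<open>The ideal of denominators of \<open>p / q\<close> in the localized ring; its
    generator \<open>h\<close> is not a unit since \<open>q\<close> does not divide \<open>p\<close>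
    there.\<close>
  define D where "D = {h. ldvd q (h * p)}"
  obtain h where h: "h \<in> D" "h \<noteq> 0" and gen: "\<And>a. a \<in> D \<Longrightarrow> ldvd h a"
  proof (rule ideal_generator[of D q])
    show "a + b \<in> D" if "a \<in> D" "b \<in> D" for a b
      using that ldvd_add by (auto simp: D_def distrib_right)
    show "b * a \<in> D" if "a \<in> D" for a b
      using that ldvd_mult[of q "a * p" b] by (simp add: D_def mult.assoc)
    show "q \<in> D"
      by (auto simp: D_def intro: dvd_imp_ldvd)
  qed (use assms(2) in auto)
  have "ldeg h > 0"
    using h not ldvd_cancel[of q h p] by (auto simp: D_def)
  \<comment> \<open>A divisor of \<open>h\<close> of least positive degree is irreducible, as its
    own divisors divide \<open>h\<close> too.\<close>
  define Q where "Q = (\<lambda>d. ldvd d h \<and> ldeg d > 0)"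
  have "Q h"
    using \<open>ldeg h > 0\<close> by (auto simp: Q_def intro: dvd_imp_ldvd)
  then obtain \<pi> where \<pi>: "Q \<pi>" and min: "\<And>d. Q d \<Longrightarrow> ldeg \<pi> \<le> ldeg d"
    using ex_has_least_nat[of Q h ldeg] by blast
  interpret irreducible_direction c v0 \<pi>
    by unfold_locales (use \<pi> min ldvd_trans in \<open>auto simp: Q_def\<close>)
  have "\<xi> \<in> J" if \<xi>: "\<xi> \<in> hypersurface" for \<xi>
  proof (rule ccontr)
    assume "\<xi> \<notin> J"
    then obtain p' q' where q': "p * q' = p' * q" "eval_mp q' \<xi> \<noteq> 0"
      using local by blast
    have "q' \<in> D"
      using q'(1) by (auto simp: D_def mult.commute[of q'] intro: dvd_imp_ldvd)
    then have "ldvd \<pi> q'"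
      using gen \<pi> ldvd_trans by (auto simp: Q_def)
    then show False
      using \<xi> q'(2) by (auto simp: hypersurface_def)
  qed
  then show False
    using hypersurface_not_subset[OF assms(1)] by blast
qed

end

subsection \<open>Choice of the direction\<close>

definition tdeg :: "('v::finite \<Rightarrow>\<^sub>0 nat) \<Rightarrow> nat" where
  "tdeg m = (\<Sum>v\<in>UNIV. lookup m v)"

text \<open>Bounds replace exact degrees because a factor loses its top term when the corresponding
  entry of the direction is 0.\<close>

lemma coeff_prod_top:
  assumes "finite A" "\<And>v. v \<in> A \<Longrightarrow> degree (f v) \<le> n v"
  shows "degree (\<Prod>v\<in>A. f v) \<le> (\<Sum>v\<in>A. n v) \<and>
    coeff (\<Prod>v\<in>A. f v) (\<Sum>v\<in>A. n v) = (\<Prod>v\<in>A. coeff (f v) (n v))"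
  using assms
proof (induction A rule: finite_induct)
  case (insert v A)
  have mult: "degree (p * q) \<le> a + b \<and> coeff (p * q) (a + b) = coeff p a * coeff q b"
    if "degree p \<le> a" "degree q \<le> b" for p q :: "'b poly" and a b
  proof
    show "degree (p * q) \<le> a + b"
      using degree_mult_le[of p q] that by linarith
    have "(\<Sum>i\<le>a + b. coeff p i * coeff q (a + b - i)) = (\<Sum>i\<le>a + b. if i = a then coeff p a * coeff q b else 0)"
    proof (intro sum.cong refl)
      fix i
      assume "i \<in> {..a + b}"
      show "coeff p i * coeff q (a + b - i) = (if i = a then coeff p a * coeff q b else 0)"
        using that by (cases i a rule: linorder_cases) (auto simp: coeff_eq_0)
    qed
    then show "coeff (p * q) (a + b) = coeff p a * coeff q b"
      by (simp add: coeff_mult)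
  qed
  show ?case
    using insert mult[of "f v" "n v" "\<Prod>v\<in>A. f v" "\<Sum>v\<in>A. n v"] by simp
qed simp

lemma shift_single_top:
  fixes m :: "'v::finite \<Rightarrow>\<^sub>0 nat" and a :: "'k::comm_ring_1"
  shows "degree (shift_mp c (single m a)) \<le> tdeg m"
    and "coeff (shift_mp c (single m a)) (tdeg m) = const_mp (a * (\<Prod>v\<in>UNIV. c v ^ lookup m v))"
proof -
  let ?f = "\<lambda>v. [:var_mp v, const_mp (c v):] ^ lookup m v :: ('v, 'k) mpol poly"
  have pow: "degree ([:x, y:] ^ n) \<le> n \<and> coeff ([:x, y:] ^ n) n = y ^ n" for x y :: "('v, 'k) mpol" and n
    using coeff_prod_top[of "{..<n}" "\<lambda>_. [:x, y:]" "\<lambda>_. 1"] by simp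
  have top: "degree (\<Prod>v\<in>UNIV. ?f v) \<le> tdeg m \<and>
      coeff (\<Prod>v\<in>UNIV. ?f v) (tdeg m) = (\<Prod>v\<in>UNIV. coeff (?f v) (lookup m v))"
    unfolding tdeg_def by (rule coeff_prod_top) (use pow in auto)
  have shift: "shift_mp c (single m a) = smult (const_mp a) (\<Prod>v\<in>UNIV. ?f v)"
    by (simp add: shift_mp_def subst_mp_single[OF ring_hom_fn_const_poly])
  show "degree (shift_mp c (single m a)) \<le> tdeg m"
    unfolding shift using top degree_smult_le order_trans by blast
  have "(\<Prod>v\<in>A. const_mp (g v)) = (const_mp (prod g A) :: ('v, 'k) mpol)" for A :: "'v set" and g
    by (induction A rule: infinite_finite_induct) simp_all
  then show "coeff (shift_mp c (single m a)) (tdeg m) = const_mp (a * (\<Prod>v\<in>UNIV. c v ^ lookup m v))"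
    unfolding shift using top pow by (simp add: const_mp_power[symmetric])
qed

text \<open>The coefficient of the highest power of \<open>s\<close> in q(x + s c) is the top
  homogeneous part of \<open>q\<close>, for the total degree, evaluated at \<open>c\<close>. It is a
  constant, and \<open>c\<close> is chosen with this value nonzero.\<close>

lemma ex_direction:
  fixes q :: "('v::finite, 'k::{alg_closed_field, field_char_0}) mpol"
  assumes "q \<notin> range const_mp"
  obtains c v0 k where "direction c v0" "direction.lcoef c q = const_mp k"
proof -
  define d where "d = Max (tdeg ` keys q)"
  define M where "M = {m \<in> keys q. tdeg m = d}"
  have "q \<noteq> 0"
    using assms by (metis const_mp_simps(1) rangeI)
  then have "d \<in> tdeg ` keys q"
    unfolding d_def by (intro Max_in) auto
  then obtain m0 where m0: "m0 \<in> M"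
    by (auto simp: M_def)
  have le: "tdeg m \<le> d" if "m \<in> keys q" for m
    using that by (simp add: d_def)
  obtain c where c: "(\<Sum>m\<in>M. lookup q m * (\<Prod>v\<in>UNIV. c v ^ lookup m v)) \<noteq> 0"
    using monomial_sum_eq_0[of M "lookup q" m0] m0 by (auto simp: M_def in_keys_iff)
  define k where "k = (\<Sum>m\<in>M. lookup q m * (\<Prod>v\<in>UNIV. c v ^ lookup m v))"
  have q: "shift_mp c q = (\<Sum>m\<in>keys q. shift_mp c (single m (lookup q m)))"
    by (subst (1) sum_single_keys[of q, symmetric]) simp
  have deg: "degree (shift_mp c q) \<le> d"
    unfolding q by (intro degree_sum_le order_trans[OF shift_single_top(1) le]) auto
  have "coeff (shift_mp c q) d = (\<Sum>m\<in>keys q. if tdeg m = d then const_mp (lookup q m * (\<Prod>v\<in>UNIV. c v ^ lookup m v)) else 0)"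
    unfolding q coeff_sum
  proof (intro sum.cong refl)
    fix m
    assume m: "m \<in> keys q"
    show "coeff (shift_mp c (single m (lookup q m))) d
        = (if tdeg m = d then const_mp (lookup q m * (\<Prod>v\<in>UNIV. c v ^ lookup m v)) else 0)"
    proof (cases "tdeg m = d")
      case True
      then show ?thesis
        using shift_single_top(2)[of c m "lookup q m"] by simp
    next
      case False
      then have "degree (shift_mp c (single m (lookup q m))) < d"
        using le[OF m] shift_single_top(1)[of c m "lookup q m"] by linarith
      then show ?thesis
        using False by (simp add: coeff_eq_0)
    qed
  qed
  also have "\<dots> = (\<Sum>m\<in>M. const_mp (lookup q m * (\<Prod>v\<in>UNIV. c v ^ lookup m v)))"
    unfolding M_def by (rule sum.inter_filter[symmetric]) simp
  also have "\<dots> = const_mp k"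
  proof -
    have "(\<Sum>m\<in>A. const_mp (g m)) = (const_mp (sum g A) :: ('v, 'k) mpol)" for A and g :: "('v \<Rightarrow>\<^sub>0 nat) \<Rightarrow> 'k"
      by (induction A rule: infinite_finite_induct) simp_all
    then show ?thesis
      unfolding k_def .
  qed
  finally have top: "coeff (shift_mp c q) d = const_mp k" .
  have "const_mp k \<noteq> (0 :: ('v, 'k) mpol)"
    using c by (metis eval_const eval_simps(4) k_def)
  then have d: "degree (shift_mp c q) = d"
    using deg le_degree[of "shift_mp c q" d] top by simp
  \<comment> \<open>At \<open>c = 0\<close> the top part could be nonzero only in degree 0, that is,
    for the excluded constant \<open>q\<close>.\<close>
  have "\<exists>v. c v \<noteq> 0"
  proof (rule ccontr)
    assume c0: "\<not> ?thesis"
    have "d = 0"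
    proof (rule ccontr)
      assume "d \<noteq> 0"
      have "c = (\<lambda>_. 0)"
        using c0 by auto
      have "(\<Prod>v\<in>UNIV. c v ^ lookup m v) = 0" if "m \<in> M" for m
      proof -
        have "tdeg m \<noteq> 0"
          using that \<open>d \<noteq> 0\<close> by (simp add: M_def)
        then have "\<exists>v. lookup m v \<noteq> 0"
          unfolding tdeg_def by (rule contrapos_np) simp
        then show ?thesis
          using \<open>c = (\<lambda>_. 0)\<close> by auto
      qed
      then have "(\<Sum>m\<in>M. lookup q m * (\<Prod>v\<in>UNIV. c v ^ lookup m v)) = 0"
        by (intro sum.neutral ballI) (simp only: mult_zero_right)
      then show False
        using c by simp
    qed
    then have "q = const_mp k"
      using top poly_shift_0[of c q] by (simp add: poly_0_coeff_0)
    then show False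
      using assms by blast
  qed
  then obtain v0 where "c v0 \<noteq> 0"
    by blast
  then have "direction c v0"
    by unfold_locales
  moreover have "direction.lcoef c q = const_mp k"
    using direction.lcoef_def[OF \<open>direction c v0\<close>] direction.ldeg_def[OF \<open>direction c v0\<close>] d top by simp
  ultimately show ?thesis
    by (rule that)
qed

text \<open>A rational function that is regular away from a set of codimension at least two is a polynomial.\<close>
lemma dvd_of_codim_ge_2:
  fixes p q :: "('v::finite, 'k::{alg_closed_field, field_char_0}) mpol"
  assumes "codim_ge_2 J" "q \<noteq> 0"
    and local: "\<And>\<xi>. \<xi> \<notin> J \<Longrightarrow> \<exists>p' q'. p * q' = p' * q \<and> eval_mp q' \<xi> \<noteq> 0"
  shows "q dvd p"
proof (cases "q \<in> range const_mp")
  case True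
  then obtain k where k: "q = const_mp k"
    by blast
  then have "k \<noteq> 0"
    using assms(2) by auto
  then have "p = q * (const_mp (inverse k) * p)"
    unfolding k mult.assoc[symmetric] by simp
  then show ?thesis
    by (rule dvdI)
next
  case False
  then obtain c v0 k where dir: "direction c v0" "direction.lcoef c q = const_mp k"
    by (rule ex_direction)
  interpret direction c v0
    by (rule dir)
  show ?thesis
    using dvd_of_ldvd[OF assms(2) dir(2)] ldvd_of_codim_ge_2[OF assms] by blast
qed

subsection \<open>Polynomial partial derivatives along the generators\<close>

text \<open>The coefficients are the fractions \<open>vf (X j) g\<close> over
  \<open>\<Delta>\<close>. Pairing the differential of \<open>g\<close> with another frame gives the
  same fraction with denominator \<open>\<Delta>'\<close>, so it is regular wherever some frame is
  nondegenerate.\<close>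

lemma ex_polynomial_differential:
  fixes fs :: "('v::finite, 'k::{alg_closed_field, field_char_0}) mpol list"
  assumes codim: "codim_ge_2 (jacobian_locus fs)" and dep: "dependent_on fs g"
  obtains a where "\<And>v. pderiv_mp v g = (\<Sum>j<length fs. a j * pderiv_mp v (fs ! j))"
proof -
  let ?s = "length fs"
  obtain \<eta> where "\<eta> \<notin> jacobian_locus fs"
    using codim_ge_2_neq_UNIV[OF codim] by blast
  then obtain X \<Delta> where frame: "dual_frame fs ?s X \<Delta>" and "eval_mp \<Delta> \<eta> \<noteq> 0"
    by (rule ex_dual_frame)
  then have \<Delta>: "\<Delta> \<noteq> 0"
    by auto
  note dg = dependent_on_differential[OF dep frame]
  have "\<Delta> dvd vf (X j) g" if j: "j < ?s" for j
  proof (rule dvd_of_codim_ge_2[OF codim \<Delta>])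
    fix \<xi>
    assume "\<xi> \<notin> jacobian_locus fs"
    then obtain X' \<Delta>' where frame': "dual_frame fs ?s X' \<Delta>'" and \<Delta>': "eval_mp \<Delta>' \<xi> \<noteq> 0"
      by (rule ex_dual_frame)
    have "\<Delta> * vf (X' j) g = (\<Sum>i<?s. vf (X i) g * vf (X' j) (fs ! i))"
      by (rule vf_differential[OF dg])
    also have "\<dots> = (\<Sum>i<?s. if i = j then vf (X i) g * \<Delta>' else 0)"
      using frame' j by (intro sum.cong) (auto simp: dual_frame_def)
    also have "\<dots> = vf (X j) g * \<Delta>'"
      using j by simp
    finally show "\<exists>p' q'. vf (X j) g * q' = p' * \<Delta> \<and> eval_mp q' \<xi> \<noteq> 0"
      using \<Delta>' by (intro exI[of _ "vf (X' j) g"] exI[of _ \<Delta>']) (simp add: mult.commute)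
  qed
  then have "\<forall>j. \<exists>b. j < ?s \<longrightarrow> vf (X j) g = \<Delta> * b"
    by (meson dvdE)
  then obtain a where a: "\<And>j. j < ?s \<Longrightarrow> vf (X j) g = \<Delta> * a j"
    by metis
  have "pderiv_mp v g = (\<Sum>j<?s. a j * pderiv_mp v (fs ! j))" for v
  proof (rule mpol_mult_cancel_left[OF _ \<Delta>])
    show "\<Delta> * pderiv_mp v g = \<Delta> * (\<Sum>j<?s. a j * pderiv_mp v (fs ! j))"
      unfolding dg sum_distrib_left by (intro sum.cong) (auto simp: a mult.assoc)
  qed
  then show ?thesis
    by (rule that)
qed

text \<open>The frame depends on \<open>fs\<close> only and serves at every stage of the induction;
  positive \<open>d j\<close> make the weights \<open>e - d j\<close> of the coefficients
  drop.\<close>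

lemma dependent_on_homog_imp_subalg_gen:
  fixes fs :: "('v::finite, 'k::{alg_closed_field, field_char_0}) mpol list"
  assumes w: "\<forall>v. w v > 0" and codim: "codim_ge_2 (jacobian_locus fs)"
    and hom: "\<And>j. j < length fs \<Longrightarrow> homog w (d j) (fs ! j)"
    and d: "\<And>j. j < length fs \<Longrightarrow> d j > 0"
    and frame: "dual_frame fs (length fs) X \<Delta>" "\<Delta> \<noteq> 0"
    and dep: "dependent_on fs g" "homog w e g"
  shows "g \<in> subalg_gen (set fs)"
  using dep
proof (induction e arbitrary: g rule: less_induct)
  case (less e)
  let ?s = "length fs" and ?R = "subalg_gen (set fs)"
  show ?case
  proof (cases "e = 0")
    case True
    then show ?thesis
      using homog_0_const[of w g] less.prems w subalg_gen.const by metis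
  next
    case False
    obtain a where a: "\<And>v. pderiv_mp v g = (\<Sum>j<?s. a j * pderiv_mp v (fs ! j))"
      using ex_polynomial_differential[OF codim less.prems(1)] by blast
    \<comment> \<open>Only the component of \<open>a j\<close> of weight \<open>e - d j\<close>
      contributes to weight \<open>e\<close>; for \<open>d j > e\<close> there is none.\<close>
    define b where "b j = (if d j \<le> e then comp_mp w (e - d j) (a j) else 0)" for j
    have dg: "pderiv_mp v g = (\<Sum>j<?s. b j * pderiv_mp v (fs ! j))" for v
      using comp_mp_differential[of g a fs ?s w d v e] a hom
      unfolding b_def comp_mp_homog[OF less.prems(2)] by simp
    have b: "b j \<in> ?R" if "j < ?s" for j
    proof (cases "d j \<le> e")
      case True
      then have "homog w (e - d j) (b j)"
        by (simp add: b_def homog_comp_mp)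
      moreover have "e - d j < e"
        using d[OF that] False by simp
      ultimately show ?thesis
        using less.IH dependent_on_coefficient[OF dg frame that] by blast
    qed (simp add: b_def subalg_gen_0)
    \<comment> \<open>Euler is applied to \<open>g\<close>, then to each generator; characteristic 0
      allows the final division by \<open>e\<close>.\<close>
    have "of_nat e * g = (\<Sum>v\<in>UNIV. of_nat (w v) * (var_mp v * pderiv_mp v g))"
      using euler_identity[OF less.prems(2)] by simp
    also have "\<dots> = (\<Sum>j<?s. b j * (\<Sum>v\<in>UNIV. of_nat (w v) * (var_mp v * pderiv_mp v (fs ! j))))"
      unfolding dg sum_distrib_left by (subst sum.swap) (simp add: mult_ac)
    also have "\<dots> = (\<Sum>j<?s. b j * (of_nat (d j) * fs ! j))"
      by (intro sum.cong refl) (simp add: euler_identity[OF hom])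
    also have "\<dots> \<in> ?R"
      by (intro subalg_gen_sum subalg_gen.mult subalg_gen_of_nat_mult b subalg_gen.gen) auto
    finally have "const_mp (inverse (of_nat e)) * (const_mp (of_nat e) * g) \<in> ?R"
      unfolding const_mp_of_nat by (rule subalg_gen.mult[OF subalg_gen.const])
    moreover have "const_mp (inverse (of_nat e)) * (const_mp (of_nat e) * g) = g"
      using False const_mp_inverse[of "of_nat e :: 'k"]
      by (simp add: mult.assoc[symmetric] mult.commute[of "const_mp (inverse _)"])
    ultimately show ?thesis
      by (simp only:)
  qed
qed

theorem theorem1p1:
  fixes w :: "'v::finite \<Rightarrow> nat"
    and fs :: "('v, 'k::{alg_closed_field, field_char_0}) mpol list"
    and g :: "('v, 'k) mpol"
  assumes "\<forall>v. w v > 0"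
    and "\<forall>f\<in>set fs. homogeneous_mp w f"
    and "codim_ge_2 (jacobian_locus fs)"
    and "algebraic_over (subalg_gen (set fs)) g"
  shows "g \<in> subalg_gen (set fs)"
proof -
  have "\<forall>j. \<exists>e. j < length fs \<longrightarrow> homog w e (fs ! j)"
    using assms(2) unfolding homogeneous_mp_def homog_def weight_def by (metis nth_mem)
  then obtain d where hom: "\<And>j. j < length fs \<Longrightarrow> homog w (d j) (fs ! j)"
    by metis
  obtain \<eta> where "\<eta> \<notin> jacobian_locus fs"
    using codim_ge_2_neq_UNIV[OF assms(3)] by blast
  then obtain X \<Delta> where frame: "dual_frame fs (length fs) X \<Delta>" and "eval_mp \<Delta> \<eta> \<noteq> 0"
    by (rule ex_dual_frame)
  then have \<Delta>: "\<Delta> \<noteq> 0"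
    by auto
  \<comment> \<open>A generator of weight 0 would be constant and killed by \<open>X j\<close>,
    against the diagonal value \<open>\<Delta>\<close>.\<close>
  have d: "d j > 0" if "j < length fs" for j
  proof (rule ccontr)
    assume "\<not> d j > 0"
    then have "fs ! j = const_mp (lookup (fs ! j) 0)"
      using homog_0_const[of w "fs ! j"] hom[OF that] assms(1) by simp
    then have "vf (X j) (fs ! j) = 0"
      by (metis vf_const)
    then show False
      using frame \<Delta> that by (simp add: dual_frame_def)
  qed
  have dep: "dependent_on fs g"
    by (rule algebraic_imp_dependent_on[OF assms(4)])
  obtain a where a: "\<And>v. pderiv_mp v g = (\<Sum>j<length fs. a j * pderiv_mp v (fs ! j))"
    using ex_polynomial_differential[OF assms(3) dep] by blast
  \<comment> \<open>Taking components of the expansion of the differential shows that each component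
    of \<open>g\<close> is again dependent on \<open>fs\<close>, so the homogeneous case
    applies.\<close>
  have "comp_mp w e g \<in> subalg_gen (set fs)" for e
  proof (rule dependent_on_homog_imp_subalg_gen[OF assms(1,3) hom d frame \<Delta>])
    show "dependent_on fs (comp_mp w e g)"
      by (rule dependent_onI, rule comp_mp_differential[OF a hom])
    show "homog w e (comp_mp w e g)"
      by (rule homog_comp_mp)
  qed
  then have "(\<Sum>e\<in>weight w ` keys g. comp_mp w e g) \<in> subalg_gen (set fs)"
    by (rule subalg_gen_sum)
  then show ?thesis
    using sum_comp_mp[of g w] by simp
qed

end
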